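(* Let $2<p\le q<\infty$ and let $\alpha\in\mathbb{R}$ satisfy $\alpha<p/q'-1$. Then $$\mathcal{L}\colon L^p(\mathbb{R}_+,x^\alpha\,dx)\to A^q_{q/p'-2-\alpha q/p}(\mathbb{C}_+)$$ is bounded, i.e. there is a constant $C>0$ such that $\mathcal{L}f\in A^q_{q/p'-2-\alpha q/p}(\mathbb{C}_+)$ and $\|\mathcal{L}f\|_{A^q_{q/p'-2-\alpha q/p}(\mathbb{C}_+)}\le C\left(\int_0^\infty|f(x)|^px^\alpha\,dx\right)^{1/p}$ for all $f\in L^p(\mathbb{R}_+,x^\alpha\,dx)$.
   Context: $\mathbb{R}_+=(0,\infty)$ and $\mathbb{C}_+=\{z\in\mathbb{C}:\operatorname{Im}z>0\}$. Conjugate exponents are $p'=p/(p-1)$, $q'=q/(q-1)$. The Laplace transform is $\mathcal{L}f(z)=\int_0^\infty f(t)e^{2\pi i tz}\,dt$ for $z\in\mathbb{C}_+$. For $\beta>-1$, the standard weighted Bergman space $A^q_\beta(\mathbb{C}_+)$ is the space of analytic functions $F\colon\mathbb{C}_+\to\mathbb{C}$ such that $\|F\|_{A^q_\beta(\mathbb{C}_+)}^q:=\int_0^\infty\int_{\mathbb{R}}|F(x+iy)|^q y^\beta\,dx\,dy<\infty$. *)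

theory Defs
  imports "HOL-Complex_Analysis.Complex_Analysis"
begin

definition conj_exponent :: "real \<Rightarrow> real"
  where "conj_exponent p = p / (p - 1)"

definition upper_half_plane :: "complex set"
  where "upper_half_plane = {z. Im z > 0}"

text \<open>
  Functions on the positive half-line, and on the upper half-plane, are represented by total
  functions; their values elsewhere never matter. The spaces consist of functions rather than of
  classes modulo almost-everywhere equality, so the norms below are seminorms on the total functions.
\<close>

definition weighted_Lp_power :: "real \<Rightarrow> real \<Rightarrow> (real \<Rightarrow> complex) \<Rightarrow> ennreal"
  where "weighted_Lp_power p \<alpha> f =
    (\<integral>\<^sup>+x\<in>{0<..}. ennreal (norm (f x) powr p * x powr \<alpha>) \<partial>lebesgue)"

definition weighted_Lp :: "real \<Rightarrow> real \<Rightarrow> (real \<Rightarrow> complex) set"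
  where "weighted_Lp p \<alpha> =
    {f. f \<in> borel_measurable (lebesgue_on {0<..}) \<and> weighted_Lp_power p \<alpha> f < \<infinity>}"

definition weighted_Lp_norm :: "real \<Rightarrow> real \<Rightarrow> (real \<Rightarrow> complex) \<Rightarrow> real"
  where "weighted_Lp_norm p \<alpha> f = enn2real (weighted_Lp_power p \<alpha> f) powr (1 / p)"

definition bergman_power :: "real \<Rightarrow> real \<Rightarrow> (complex \<Rightarrow> complex) \<Rightarrow> ennreal"
  where "bergman_power q \<beta> F =
    (\<integral>\<^sup>+y\<in>{0<..}. (\<integral>\<^sup>+x. ennreal (norm (F (Complex x y)) powr q * y powr \<beta>) \<partial>lborel) \<partial>lborel)"

definition bergman_space :: "real \<Rightarrow> real \<Rightarrow> (complex \<Rightarrow> complex) set"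
  where "bergman_space q \<beta> =
    {F. F holomorphic_on upper_half_plane \<and> bergman_power q \<beta> F < \<infinity>}"

definition bergman_norm :: "real \<Rightarrow> real \<Rightarrow> (complex \<Rightarrow> complex) \<Rightarrow> real"
  where "bergman_norm q \<beta> F = enn2real (bergman_power q \<beta> F) powr (1 / q)"

definition laplace_integrand :: "(real \<Rightarrow> complex) \<Rightarrow> complex \<Rightarrow> real \<Rightarrow> complex"
  where "laplace_integrand f z t = f t * exp (2 * of_real pi * \<i> * of_real t * z)"

text \<open>
  The Bochner integral is \<open>0\<close> by convention when the integrand is not integrable, so
  integrability has to be asserted separately wherever the transform is claimed to be defined.
\<close>

definition laplace :: "(real \<Rightarrow> complex) \<Rightarrow> complex \<Rightarrow> complex"
  where "laplace f z = (LINT t:{0<..}|lebesgue. laplace_integrand f z t)"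

end

theory Submission
  imports Defs "HOL-Probability.Characteristic_Functions"
begin

text \<open>
  For fixed \<open>y\<close>, the function \<open>x \<mapsto> \<L>f(x + iy)\<close> is the Fourier transform of \<open>f(t) exp(-2\<pi>yt)\<close>, so
  Hausdorff--Young bounds its \<open>q\<close>-th power integral by a constant times \<open>G(y)\<close> to the power
  \<open>q / q' = q - 1\<close>, where \<open>G(y)\<close> is the real Laplace transform of \<open>h = |f|\<close> to the power \<open>q'\<close>.
  With \<open>s = p / q'\<close> and \<open>b\<close> in \<open>{\<alpha><..<s - 1}\<close>, Hoelder's inequality bounds \<open>G(y)\<close> to the power \<open>s\<close> by a
  power of \<open>y\<close> times the integral of \<open>h(t)\<close> to the \<open>s\<close>, weighted by \<open>t\<close> to the \<open>b\<close> and the exponential,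
  which Tonelli integrates exactly in \<open>y\<close>; the surplus exponent \<open>q - 1 - s\<close> is absorbed by the pointwise
  bound on \<open>G\<close> that the same inequality gives with \<open>b = \<alpha>\<close>.
\<close>

section \<open>The Fourier transform on the line\<close>

text \<open>The positive sign in the exponent matches the Laplace kernel, so that restricting
  \<open>laplace f\<close> to a horizontal line needs no reflection.\<close>

definition fourier :: "(real \<Rightarrow> complex) \<Rightarrow> real \<Rightarrow> complex"
  where "fourier g x = (LINT t|lborel. g t * cis (2 * pi * t * x))"

text \<open>Rescaling by \<open>n\<close> reduces this to the characteristic function of the
  standard normal distribution. A wide Gaussian transforms into a narrow one, which serves as the
  averaging kernel in \<open>plancherel_le\<close>.\<close>

lemma integral_gaussian_cis:
  fixes n u :: real
  assumes n: "n > 0"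
  shows "(LINT x|lborel. of_real (exp (- (x / n)\<^sup>2 / 2)) * cis (2 * pi * u * x)) =
    complex_of_real (n * sqrt (2 * pi) * exp (- (2 * pi * u * n)\<^sup>2 / 2))"
proof -
  have "complex_of_real (exp (- (2 * pi * u * n)\<^sup>2 / 2)) = char std_normal_distribution (2 * pi * u * n)"
    by (simp add: char_std_normal_distribution)
  also have "\<dots> = (LINT x|lborel. std_normal_density x *\<^sub>R cis (2 * pi * u * n * x))"
    unfolding char_def by (subst integral_density) (auto simp: cis_conv_exp)
  finally have 1: "(LINT x|lborel. std_normal_density x *\<^sub>R cis (2 * pi * u * n * x)) = complex_of_real (exp (- (2 * pi * u * n)\<^sup>2 / 2))" ..
  have "(LINT x|lborel. of_real (exp (- (x / n)\<^sup>2 / 2)) * cis (2 * pi * u * x)) =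
    \<bar>n\<bar> *\<^sub>R (LINT x|lborel. of_real (exp (- ((0 + n * x) / n)\<^sup>2 / 2)) * cis (2 * pi * u * (0 + n * x)))"
    using n by (intro lborel_integral_real_affine) auto
  also have "(LINT x|lborel. of_real (exp (- ((0 + n * x) / n)\<^sup>2 / 2)) * cis (2 * pi * u * (0 + n * x)))
     = (LINT x|lborel. sqrt (2 * pi) *\<^sub>R (std_normal_density x *\<^sub>R cis (2 * pi * u * n * x)))"
    using n by (intro Bochner_Integration.integral_cong)
      (auto simp: std_normal_density_def scaleR_conv_of_real mult_ac)
  also have "\<dots> = sqrt (2 * pi) *\<^sub>R complex_of_real (exp (- (2 * pi * u * n)\<^sup>2 / 2))"
    by (simp only: integral_scaleR_right 1)
  finally show ?thesis using n by (simp add: scaleR_conv_of_real mult_ac)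
qed

lemma borel_measurable_cis [measurable]: "cis \<in> borel_measurable borel"
  by (intro borel_measurable_continuous_onI continuous_intros)

lemma borel_measurable_cnj [measurable]: "cnj \<in> borel_measurable borel"
  by (intro borel_measurable_continuous_onI continuous_intros)

lemma borel_measurable_fourier [measurable]:
  assumes [measurable]: "g \<in> borel_measurable borel"
  shows "fourier g \<in> borel_measurable borel"
  unfolding fourier_def by measurable

text \<open>If \<open>f\<close> is not integrable, its Bochner integral is 0 by convention and the
  bound is trivial.\<close>

lemma norm_integral_le_nn_integral:
  fixes f :: "'a \<Rightarrow> 'b :: {banach, second_countable_topology}"
  shows "ennreal (norm (integral\<^sup>L M f)) \<le> (\<integral>\<^sup>+x. ennreal (norm (f x)) \<partial>M)"
  by (cases "integrable M f") (auto simp: integral_norm_bound_ennreal not_integrable_integral_eq)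

lemma integrable_mult_cis:
  assumes "integrable lborel g" and [measurable]: "c \<in> borel_measurable borel"
  shows "integrable lborel (\<lambda>t. g t * cis (c t))"
proof -
  have [measurable]: "g \<in> borel_measurable borel" using assms by auto
  show ?thesis by (rule Bochner_Integration.integrable_bound[OF assms(1)]) (auto simp: norm_mult)
qed

lemma norm_fourier_le:
  assumes "integrable lborel g"
  shows "norm (fourier g x) \<le> (LINT t|lborel. norm (g t))"
  unfolding fourier_def
  by (rule order_trans[OF integral_norm_bound]) (simp add: norm_mult)

section \<open>Plancherel's inequality for integrable functions\<close>

text \<open>
  The Gaussian weight makes Fubini applicable and turns the left-hand side into a double integral
  against a symmetric probability kernel, which AM-GM bounds; the weight is removed by Fatou.
\<close>

lemma plancherel_le:
  fixes g :: "real \<Rightarrow> complex"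
  assumes g: "integrable lborel g"
  shows "(\<integral>\<^sup>+x. ennreal ((norm (fourier g x))\<^sup>2) \<partial>lborel) \<le> (\<integral>\<^sup>+t. ennreal ((norm (g t))\<^sup>2) \<partial>lborel)"
proof -
  have gm [measurable]: "g \<in> borel_measurable borel" using g by auto
  define w where "w n x = exp (- (x / n)\<^sup>2 / 2)" for n x :: real
  have wm [measurable]: "w n \<in> borel_measurable borel" for n unfolding w_def by measurable
  have w: "0 \<le> w n x" "w n x \<le> 1" for n x by (auto simp: w_def)
  define k where "k n u = n * sqrt (2 * pi) * exp (- (2 * pi * u * n)\<^sup>2 / 2)" for n u :: real
  have km [measurable]: "k n \<in> borel_measurable borel" for n unfolding k_def by measurable
  have bound: "(\<integral>\<^sup>+x. ennreal (w n x * (norm (fourier g x))\<^sup>2) \<partial>lborel) \<le> (\<integral>\<^sup>+t. ennreal ((norm (g t))\<^sup>2) \<partial>lborel)"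
    if n: "n > 0" for n :: real
  proof -
    have kk: "k n u \<ge> 0" for u using n by (simp add: k_def)
    \<comment> \<open>Recognising the transform of the weight as a normal density of standard
      deviation \<open>1 / (2 * pi * n)\<close> gives it total mass 1, which is why no constant is
      lost.\<close>
    have kn: "k n (t - s) = normal_density s (1 / (2 * pi * n)) t" for t s
    proof -
      have "sqrt (2 * pi * (1 / (2 * pi * n))\<^sup>2) = sqrt (2 * pi) / (2 * pi * n)"
        using n by (simp add: real_sqrt_mult)
      then have "1 / sqrt (2 * pi * (1 / (2 * pi * n))\<^sup>2) = n * (2 * pi / sqrt (2 * pi))"
        by simp
      then have "1 / sqrt (2 * pi * (1 / (2 * pi * n))\<^sup>2) = n * sqrt (2 * pi)"
        by (subst (asm) real_div_sqrt) auto
      moreover have "- (2 * pi * (t - s) * n)\<^sup>2 / 2 = - (t - s)\<^sup>2 / (2 * (1 / (2 * pi * n))\<^sup>2)"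
        using n by (simp add: power_mult_distrib power_divide)
      ultimately show ?thesis by (simp only: k_def normal_density_def)
    qed
    have kint: "(\<integral>\<^sup>+t. ennreal (k n (t - s)) \<partial>lborel) = 1" for s
      unfolding kn using n by (subst nn_integral_eq_integral) auto
    have ksym: "k n (t - s) = k n (s - t)" for s t
      by (simp add: k_def power_mult_distrib power2_commute)
    have wint: "integrable lborel (w n)"
    proof -
      have "integrable lborel (\<lambda>x. n * sqrt (2 * pi) * normal_density 0 n x)"
        using n by (intro integrable_mult_right) auto
      also have "(\<lambda>x. n * sqrt (2 * pi) * normal_density 0 n x) = w n"
        using n by (auto simp: w_def normal_density_def power_divide real_sqrt_mult)
      finally show ?thesis .
    qed
    \<comment> \<open>Integrating in \<open>x\<close> first turns \<open>h\<close> into the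
      convolution of \<open>cnj g\<close> with \<open>k n\<close>; pairing it with \<open>g\<close>
      recovers the weighted square integral \<open>J\<close>.\<close>
    define h where "h t = (LINT x|lborel. of_real (w n x) * cnj (fourier g x) * cis (2 * pi * t * x))" for t
    have hm [measurable]: "h \<in> borel_measurable borel" unfolding h_def by measurable
    have h: "h t = (LINT s|lborel. cnj (g s) * of_real (k n (t - s)))" for t
    proof -
      have i1: "integrable (lborel \<Otimes>\<^sub>M lborel)
          (\<lambda>(x, s). of_real (w n x) * cnj (g s) * cis (2 * pi * (t - s) * x))"
      proof (rule Bochner_Integration.integrable_bound)
        show "integrable (lborel \<Otimes>\<^sub>M lborel) (\<lambda>(x, s). w n x * norm (g s))"
          using wint g by (intro lborel_pair.Fubini_integrable) (auto simp: abs_mult)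
        show "AE x in lborel \<Otimes>\<^sub>M lborel. norm (case x of (x, s) \<Rightarrow> complex_of_real (w n x) * cnj (g s) * cis (2 * pi * (t - s) * x)) \<le> norm (case x of (x, s) \<Rightarrow> w n x * norm (g s))"
          using w by (auto simp: norm_mult)
      qed measurable
      have "h t = (LINT x|lborel. LINT s|lborel. of_real (w n x) * cnj (g s) * cis (2 * pi * (t - s) * x))"
        unfolding h_def
      proof (intro Bochner_Integration.integral_cong refl)
        fix x
        have "of_real (w n x) * cnj (fourier g x) * cis (2 * pi * t * x)
          = of_real (w n x) * cis (2 * pi * t * x) * (LINT s|lborel. cnj (g s * cis (2 * pi * s * x)))"
          unfolding fourier_def Bochner_Integration.integral_cnj by (simp only: mult_ac)
        also have "\<dots> = (LINT s|lborel. of_real (w n x) * cis (2 * pi * t * x) * cnj (g s * cis (2 * pi * s * x)))"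
          by (rule integral_mult_right_zero[symmetric])
        also have "\<dots> = (LINT s|lborel. of_real (w n x) * cnj (g s) * cis (2 * pi * (t - s) * x))"
          by (intro Bochner_Integration.integral_cong refl)
             (simp add: cis_cnj cis_mult algebra_simps flip: cis_divide)
        finally show "of_real (w n x) * cnj (fourier g x) * cis (2 * pi * t * x)
          = (LINT s|lborel. of_real (w n x) * cnj (g s) * cis (2 * pi * (t - s) * x))" .
      qed
      also have "\<dots> = (LINT s|lborel. LINT x|lborel. of_real (w n x) * cnj (g s) * cis (2 * pi * (t - s) * x))"
        using lborel_pair.Fubini_integral[OF i1] by simp
      also have "\<dots> = (LINT s|lborel. cnj (g s) * of_real (k n (t - s)))"
      proof (intro Bochner_Integration.integral_cong refl)
        fix s
        have "(LINT x|lborel. of_real (w n x) * cnj (g s) * cis (2 * pi * (t - s) * x))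
          = (LINT x|lborel. cnj (g s) * (of_real (w n x) * cis (2 * pi * (t - s) * x)))"
          by (simp only: mult_ac)
        also have "\<dots> = cnj (g s) * of_real (k n (t - s))"
          using integral_gaussian_cis[OF n, of "t - s"] by (simp only: integral_mult_right_zero w_def k_def)
        finally show "(LINT x|lborel. of_real (w n x) * cnj (g s) * cis (2 * pi * (t - s) * x)) = cnj (g s) * of_real (k n (t - s))" .
      qed
      finally show ?thesis .
    qed
    \<comment> \<open>The uniform bound \<open>B\<close> on the transform dominates the integrand of
      the second Fubini exchange by a product of integrable functions of \<open>x\<close> and
      \<open>t\<close>.\<close>
    define B where "B = (LINT t|lborel. norm (g t))"
    have B: "norm (fourier g x) \<le> B" for x unfolding B_def by (rule norm_fourier_le[OF g])
    then have B0: "B \<ge> 0" using norm_ge_zero order_trans by blast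
    have i2: "integrable (lborel \<Otimes>\<^sub>M lborel)
        (\<lambda>(x, t). of_real (w n x) * cnj (fourier g x) * (g t * cis (2 * pi * t * x)))"
    proof (rule Bochner_Integration.integrable_bound)
      show "integrable (lborel \<Otimes>\<^sub>M lborel) (\<lambda>(x, s). (w n x * B) * norm (g s))"
        using wint g by (intro lborel_pair.Fubini_integrable) (auto simp: abs_mult)
      show "AE x in lborel \<Otimes>\<^sub>M lborel. norm (case x of (x, t) \<Rightarrow> of_real (w n x) * cnj (fourier g x) * (g t * cis (2 * pi * t * x))) \<le> norm (case x of (x, s) \<Rightarrow> (w n x * B) * norm (g s))"
        using w B B0 by (intro AE_I2) (auto simp: norm_mult abs_mult intro!: mult_right_mono mult_left_mono)
    qed measurable
    have i3: "integrable lborel (\<lambda>x. w n x * (norm (fourier g x))\<^sup>2)"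
    proof (rule Bochner_Integration.integrable_bound)
      show "integrable lborel (\<lambda>x. w n x * B\<^sup>2)" using wint by auto
      show "AE x in lborel. norm (w n x * (cmod (fourier g x))\<^sup>2) \<le> norm (w n x * B\<^sup>2)"
        using w B B0 by (auto intro!: mult_left_mono power_mono)
    qed measurable
    define J where "J = (LINT x|lborel. w n x * (norm (fourier g x))\<^sup>2)"
    have "complex_of_real J = (LINT x|lborel. of_real (w n x) * cnj (fourier g x) * fourier g x)"
      unfolding J_def integral_complex_of_real[symmetric]
      by (intro Bochner_Integration.integral_cong refl)
         (simp only: of_real_mult complex_norm_square mult_ac)
    also have "\<dots> = (LINT x|lborel. LINT t|lborel. of_real (w n x) * cnj (fourier g x) * (g t * cis (2 * pi * t * x)))"
      by (intro Bochner_Integration.integral_cong refl) (simp only: integral_mult_right_zero fourier_def)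
    also have "\<dots> = (LINT t|lborel. LINT x|lborel. of_real (w n x) * cnj (fourier g x) * (g t * cis (2 * pi * t * x)))"
      using lborel_pair.Fubini_integral[OF i2] by simp
    also have "\<dots> = (LINT t|lborel. g t * h t)"
    proof (intro Bochner_Integration.integral_cong refl)
      fix t
      have "(LINT x|lborel. of_real (w n x) * cnj (fourier g x) * (g t * cis (2 * pi * t * x)))
        = (LINT x|lborel. g t * (of_real (w n x) * cnj (fourier g x) * cis (2 * pi * t * x)))"
        by (simp only: mult_ac)
      then show "(LINT x|lborel. of_real (w n x) * cnj (fourier g x) * (g t * cis (2 * pi * t * x))) = g t * h t"
        by (simp only: integral_mult_right_zero h_def)
    qed
    finally have J: "complex_of_real J = (LINT t|lborel. g t * h t)" .
    have J0: "J \<ge> 0" unfolding J_def using w by (intro integral_nonneg_AE) auto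
    have nh: "ennreal (norm (h t)) \<le> (\<integral>\<^sup>+s. ennreal (norm (g s) * k n (t - s)) \<partial>lborel)" for t
    proof -
      have "ennreal (norm (h t)) \<le> (\<integral>\<^sup>+s. ennreal (norm (cnj (g s) * of_real (k n (t - s)))) \<partial>lborel)"
        unfolding h by (rule norm_integral_le_nn_integral)
      then show ?thesis using kk by (simp add: norm_mult)
    qed
    have "(\<integral>\<^sup>+x. ennreal (w n x * (norm (fourier g x))\<^sup>2) \<partial>lborel) = ennreal J"
      unfolding J_def using i3 w by (intro nn_integral_eq_integral) auto
    also have "\<dots> = ennreal (norm (LINT t|lborel. g t * h t))"
      using J J0 by (metis abs_of_nonneg norm_of_real)
    also have "\<dots> \<le> (\<integral>\<^sup>+t. ennreal (norm (g t * h t)) \<partial>lborel)"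
      by (rule norm_integral_le_nn_integral)
    also have "\<dots> \<le> (\<integral>\<^sup>+t. (\<integral>\<^sup>+s. ennreal (norm (g t) * (norm (g s) * k n (t - s))) \<partial>lborel) \<partial>lborel)"
    proof (intro nn_integral_mono)
      fix t
      have "ennreal (norm (g t * h t)) \<le> ennreal (norm (g t)) * (\<integral>\<^sup>+s. ennreal (norm (g s) * k n (t - s)) \<partial>lborel)"
        using nh[of t] by (simp add: norm_mult ennreal_mult mult_left_mono)
      also have "\<dots> = (\<integral>\<^sup>+s. ennreal (norm (g t) * (norm (g s) * k n (t - s))) \<partial>lborel)"
        by (subst nn_integral_cmult[symmetric]) (auto simp: ennreal_mult kk)
      finally show "ennreal (norm (g t * h t)) \<le> (\<integral>\<^sup>+s. ennreal (norm (g t) * (norm (g s) * k n (t - s))) \<partial>lborel)" .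
    qed
    \<comment> \<open>After AM-GM the symmetry of the kernel is used in the first summand only to
      write each kernel as centred at the argument of the remaining square, so that integrating out
      the other variable gives 1.\<close>
    also have "\<dots> \<le> (\<integral>\<^sup>+t. (\<integral>\<^sup>+s. ennreal (1/2 * (norm (g t))\<^sup>2 * k n (s - t)) + ennreal (1/2 * (norm (g s))\<^sup>2 * k n (t - s)) \<partial>lborel) \<partial>lborel)"
    proof (intro nn_integral_mono)
      fix t s
      have "norm (g t) * norm (g s) \<le> 1/2 * (norm (g t))\<^sup>2 + 1/2 * (norm (g s))\<^sup>2"
        using sum_squares_bound[of "norm (g t)" "norm (g s)"] by simp
      then have "norm (g t) * norm (g s) * k n (t - s) \<le> (1/2 * (norm (g t))\<^sup>2 + 1/2 * (norm (g s))\<^sup>2) * k n (t - s)"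
        using kk by (intro mult_right_mono)
      then have "ennreal (norm (g t) * (norm (g s) * k n (t - s))) \<le> ennreal (1/2 * (norm (g t))\<^sup>2 * k n (s - t) + 1/2 * (norm (g s))\<^sup>2 * k n (t - s))"
        by (intro ennreal_leI) (simp add: ksym[of s t] algebra_simps)
      also have "\<dots> = ennreal (1/2 * (norm (g t))\<^sup>2 * k n (s - t)) + ennreal (1/2 * (norm (g s))\<^sup>2 * k n (t - s))"
        by (rule ennreal_plus) (auto simp: kk)
      finally show "ennreal (norm (g t) * (norm (g s) * k n (t - s))) \<le> ennreal (1/2 * (norm (g t))\<^sup>2 * k n (s - t)) + ennreal (1/2 * (norm (g s))\<^sup>2 * k n (t - s))" .
    qed
    also have "\<dots> = (\<integral>\<^sup>+t. (\<integral>\<^sup>+s. ennreal (1/2 * (norm (g t))\<^sup>2 * k n (s - t)) \<partial>lborel) \<partial>lborel) + (\<integral>\<^sup>+t. (\<integral>\<^sup>+s. ennreal (1/2 * (norm (g s))\<^sup>2 * k n (t - s)) \<partial>lborel) \<partial>lborel)"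
      by (subst nn_integral_add[symmetric]) (auto intro!: nn_integral_cong nn_integral_add)
    also have "(\<integral>\<^sup>+t. (\<integral>\<^sup>+s. ennreal (1/2 * (norm (g s))\<^sup>2 * k n (t - s)) \<partial>lborel) \<partial>lborel)
        = (\<integral>\<^sup>+s. (\<integral>\<^sup>+t. ennreal (1/2 * (norm (g s))\<^sup>2 * k n (t - s)) \<partial>lborel) \<partial>lborel)"
      by (rule lborel_pair.Fubini') measurable
    also have "(\<integral>\<^sup>+t. (\<integral>\<^sup>+s. ennreal (1/2 * (norm (g t))\<^sup>2 * k n (s - t)) \<partial>lborel) \<partial>lborel) + \<dots> =
      (\<integral>\<^sup>+t. ennreal (1/2 * (norm (g t))\<^sup>2) \<partial>lborel) + (\<integral>\<^sup>+t. ennreal (1/2 * (norm (g t))\<^sup>2) \<partial>lborel)"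
    proof -
      have "(\<integral>\<^sup>+s. ennreal (1/2 * (norm (g t))\<^sup>2 * k n (s - t)) \<partial>lborel) = ennreal (1/2 * (norm (g t))\<^sup>2)" for t
      proof -
        have "(\<integral>\<^sup>+s. ennreal (1/2 * (norm (g t))\<^sup>2 * k n (s - t)) \<partial>lborel) = (\<integral>\<^sup>+s. ennreal (1/2 * (norm (g t))\<^sup>2) * ennreal (k n (s - t)) \<partial>lborel)"
          by (intro nn_integral_cong ennreal_mult) (auto simp: kk)
        also have "\<dots> = ennreal (1/2 * (norm (g t))\<^sup>2) * 1"
          by (subst nn_integral_cmult) (auto simp: kint)
        finally show ?thesis by simp
      qed
      then show ?thesis by simp
    qed
    also have "\<dots> = (\<integral>\<^sup>+t. ennreal ((norm (g t))\<^sup>2) \<partial>lborel)"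
      by (subst nn_integral_add[symmetric]) (auto intro!: nn_integral_cong simp flip: ennreal_plus)
    finally show ?thesis .
  qed
  \<comment> \<open>\<open>Suc i\<close> keeps the width positive, as \<open>bound\<close>
    requires.\<close>
  have lim: "(\<lambda>i. ennreal (w (real (Suc i)) x * (norm (fourier g x))\<^sup>2)) \<longlonglongrightarrow> ennreal ((norm (fourier g x))\<^sup>2)" for x
  proof -
    have "(\<lambda>i. w (real (Suc i)) x) \<longlonglongrightarrow> exp (- 0\<^sup>2 / 2)"
      unfolding w_def by (intro tendsto_intros LIMSEQ_Suc lim_const_over_n) auto
    from tendsto_mult_right[OF this, of "(norm (fourier g x))\<^sup>2"] show ?thesis
      by (intro tendsto_ennrealI) simp
  qed
  have "(\<integral>\<^sup>+x. ennreal ((norm (fourier g x))\<^sup>2) \<partial>lborel)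
    = (\<integral>\<^sup>+x. liminf (\<lambda>i. ennreal (w (real (Suc i)) x * (norm (fourier g x))\<^sup>2)) \<partial>lborel)"
    by (intro nn_integral_cong lim_imp_Liminf[symmetric] lim) auto
  also have "\<dots> \<le> liminf (\<lambda>i. \<integral>\<^sup>+x. ennreal (w (real (Suc i)) x * (norm (fourier g x))\<^sup>2) \<partial>lborel)"
    by (intro nn_integral_liminf) auto
  also have "\<dots> \<le> (\<integral>\<^sup>+t. ennreal ((norm (g t))\<^sup>2) \<partial>lborel)"
    by (intro order_trans[OF Liminf_le_Limsup Limsup_bounded] always_eventually allI bound) auto
  finally show ?thesis .
qed

section \<open>The Hausdorff--Young inequality by real interpolation\<close>

lemma nn_integral_powr_Icc:
  fixes a c :: real
  assumes "a > -1" "c \<ge> 0"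
  shows "(\<integral>\<^sup>+x. ennreal (x powr a) * indicator {0..c} x \<partial>lborel) = ennreal (c powr (a + 1) / (a + 1))"
  using assms by (intro nn_integral_has_integral_lebesgue' has_integral_powr_from_0) auto

text \<open>
  Marcinkiewicz interpolation: at level \<open>\<lambda>\<close> the function is cut off at a height chosen so that
  the transform of the upper part is at most \<open>\<lambda> / 2\<close> everywhere, and only the lower part, for
  which Plancherel is available, contributes to the distribution function.
\<close>

lemma hausdorff_young_pos:
  fixes q A :: real and g :: "real \<Rightarrow> complex"
  assumes q: "q > 2" and g: "integrable lborel g" and A: "A > 0"
    and gA: "(\<integral>\<^sup>+t. ennreal (norm (g t) powr (q / (q - 1))) \<partial>lborel) \<le> ennreal A"
  shows "(\<integral>\<^sup>+x. ennreal (norm (fourier g x) powr q) \<partial>lborel)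
    \<le> ennreal (q * 2 powr q / (q - 2) * A powr (q - 1))"
proof -
  have [measurable]: "g \<in> borel_measurable borel" using g by auto
  \<comment> \<open>The height solves \<open>s l powr (1 - q / (q - 1)) = l / (2 * A)\<close>. Where
    \<open>norm (g t)\<close> exceeds \<open>s l\<close>, it is at most \<open>l / (2 * A)\<close>
    times its power with exponent \<open>q / (q - 1)\<close>, so the upper part has integral at most
    \<open>l / 2\<close>.\<close>
  define s where "s l = (l / (2 * A)) powr - (q - 1)" for l :: real
  have [measurable]: "s \<in> borel_measurable borel" unfolding s_def by measurable
  define gl where "gl l t = (if norm (g t) \<le> s l then g t else 0)" for l t
  have gl_meas [measurable]: "(\<lambda>(l, t). gl l t) \<in> borel_measurable (borel \<Otimes>\<^sub>M borel)"
    unfolding gl_def by measurable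
  have gl_int: "integrable lborel (gl l)" for l
    by (rule Bochner_Integration.integrable_bound[OF g]) (auto simp: gl_def)
  have gh_int: "integrable lborel (\<lambda>t. g t - gl l t)" for l
    using g gl_int by auto
  have low: "l / 2 \<le> norm (fourier (gl l) x)" if l: "l > 0" "l \<le> norm (fourier g x)" for l x
  proof -
    have sp: "s l > 0" using l A by (simp add: s_def)
    have sl: "s l powr (1 - q / (q - 1)) = l / (2 * A)"
    proof -
      have "- (q - 1) * (1 - q / (q - 1)) = 1" using q by (simp add: field_simps)
      then show ?thesis using l A by (simp add: s_def powr_powr)
    qed
    have "ennreal (LINT t|lborel. norm (g t - gl l t)) = (\<integral>\<^sup>+t. ennreal (norm (g t - gl l t)) \<partial>lborel)"
      using gh_int by (intro nn_integral_eq_integral[symmetric]) auto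
    also have "\<dots> \<le> (\<integral>\<^sup>+t. ennreal (l / (2 * A)) * ennreal (norm (g t) powr (q / (q - 1))) \<partial>lborel)"
    proof (intro nn_integral_mono)
      fix t
      have "norm (g t - gl l t) \<le> l / (2 * A) * norm (g t) powr (q / (q - 1))"
      proof (cases "norm (g t) \<le> s l")
        case True
        then show ?thesis using l A by (simp add: gl_def)
      next
        case False
        then have gt: "norm (g t) > s l" by simp
        have "norm (g t) = norm (g t) powr (1 - q / (q - 1)) * norm (g t) powr (q / (q - 1))"
          using gt sp by (simp flip: powr_add)
        also have "\<dots> \<le> s l powr (1 - q / (q - 1)) * norm (g t) powr (q / (q - 1))"
          using gt sp q by (intro mult_right_mono powr_mono2') (auto simp: field_simps)
        finally show ?thesis using False by (simp add: gl_def sl)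
      qed
      then show "ennreal (norm (g t - gl l t)) \<le> ennreal (l / (2 * A)) * ennreal (norm (g t) powr (q / (q - 1)))"
        using l A by (subst ennreal_mult[symmetric]) (auto intro!: ennreal_leI)
    qed
    also have "\<dots> = ennreal (l / (2 * A)) * (\<integral>\<^sup>+t. ennreal (norm (g t) powr (q / (q - 1))) \<partial>lborel)"
      by (rule nn_integral_cmult) measurable
    also have "\<dots> \<le> ennreal (l / (2 * A)) * ennreal A"
      by (intro mult_left_mono gA) auto
    also have "\<dots> = ennreal (l / 2)"
      using l A by (subst ennreal_mult[symmetric]) auto
    finally have "(LINT t|lborel. norm (g t - gl l t)) \<le> l / 2"
      using l by (simp add: ennreal_le_iff)
    then have 1: "norm (fourier (\<lambda>t. g t - gl l t) x) \<le> l / 2"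
      using norm_fourier_le[OF gh_int] order_trans by blast
    have "fourier (\<lambda>t. g t - gl l t) x = fourier g x - fourier (gl l) x"
      unfolding fourier_def left_diff_distrib
      by (intro Bochner_Integration.integral_diff integrable_mult_cis g gl_int) measurable
    with 1 l(2) show ?thesis using norm_triangle_ineq2[of "fourier g x" "fourier (gl l) x"] by simp
  qed
  have fm [measurable]: "(\<lambda>(l, x). fourier (gl l) x) \<in> borel_measurable (borel \<Otimes>\<^sub>M borel)"
    unfolding fourier_def by measurable
  \<comment> \<open>Layer-cake formula combined with Chebyshev's inequality, pointwise in
    \<open>x\<close>: for \<open>l\<close> up to the modulus of the transform, \<open>low\<close>
    gives \<open>l\<^sup>2 \<le> 4 * (norm (fourier (gl l) x))\<^sup>2\<close>, which trades two
    powers of \<open>l\<close> for the square that Plancherel can integrate.\<close>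
  have pt: "ennreal (norm (fourier g x) powr q) \<le>
    (\<integral>\<^sup>+l. ennreal (4 * q * l powr (q - 3) * indicator {0<..} l) * ennreal ((norm (fourier (gl l) x))\<^sup>2) \<partial>lborel)" for x
  proof -
    let ?u = "norm (fourier g x)"
    have "ennreal (?u powr q) = ennreal q * ennreal (?u powr (q - 1 + 1) / (q - 1 + 1))"
      using q by (subst ennreal_mult[symmetric]) auto
    also have "\<dots> = ennreal q * (\<integral>\<^sup>+l. ennreal (l powr (q - 1)) * indicator {0..?u} l \<partial>lborel)"
      using q by (subst nn_integral_powr_Icc) auto
    also have "\<dots> = (\<integral>\<^sup>+l. ennreal q * (ennreal (l powr (q - 1)) * indicator {0..?u} l) \<partial>lborel)"
      by (rule nn_integral_cmult[symmetric]) measurable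
    also have "\<dots> \<le> (\<integral>\<^sup>+l. ennreal (4 * q * l powr (q - 3) * indicator {0<..} l) * ennreal ((norm (fourier (gl l) x))\<^sup>2) \<partial>lborel)"
    proof (intro nn_integral_mono)
      fix l :: real
      show "ennreal q * (ennreal (l powr (q - 1)) * indicator {0..?u} l) \<le>
        ennreal (4 * q * l powr (q - 3) * indicator {0<..} l) * ennreal ((norm (fourier (gl l) x))\<^sup>2)"
      proof (cases "l > 0 \<and> l \<le> ?u")
        case True
        then have "(l / 2)\<^sup>2 \<le> (norm (fourier (gl l) x))\<^sup>2"
          using low by (intro power_mono) auto
        then have "l\<^sup>2 \<le> 4 * (norm (fourier (gl l) x))\<^sup>2" by (simp add: power_divide)
        then have "q * l powr (q - 3) * l\<^sup>2 \<le> q * l powr (q - 3) * (4 * (norm (fourier (gl l) x))\<^sup>2)"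
          using q by (intro mult_left_mono) auto
        moreover have "l powr (q - 1) = l powr (q - 3) * l\<^sup>2"
        proof -
          have "l powr (q - 1) = l powr (q - 3) * l powr 2"
            by (simp flip: powr_add)
          then show ?thesis using True by simp
        qed
        ultimately have "q * l powr (q - 1) \<le> 4 * q * l powr (q - 3) * (norm (fourier (gl l) x))\<^sup>2"
          by (simp add: mult_ac)
        then show ?thesis using True q
          by (simp add: ennreal_mult[symmetric] ennreal_leI)
      next
        case False
        \<comment> \<open>At \<open>l = 0\<close> the closed interval still counts, but
          \<open>0 powr (q - 1)\<close> is 0.\<close>
        then show ?thesis by (cases "l = 0") (auto simp: indicator_def)
      qed
    qed
    finally show ?thesis .
  qed
  have "(\<integral>\<^sup>+x. ennreal (norm (fourier g x) powr q) \<partial>lborel) \<le>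
    (\<integral>\<^sup>+x. (\<integral>\<^sup>+l. ennreal (4 * q * l powr (q - 3) * indicator {0<..} l) * ennreal ((norm (fourier (gl l) x))\<^sup>2) \<partial>lborel) \<partial>lborel)"
    by (intro nn_integral_mono pt)
  also have "\<dots> = (\<integral>\<^sup>+l. (\<integral>\<^sup>+x. ennreal (4 * q * l powr (q - 3) * indicator {0<..} l) * ennreal ((norm (fourier (gl l) x))\<^sup>2) \<partial>lborel) \<partial>lborel)"
    by (rule lborel_pair.Fubini') measurable
  also have "\<dots> \<le> (\<integral>\<^sup>+l. (\<integral>\<^sup>+t. ennreal (4 * q * l powr (q - 3) * indicator {0<..} l) * ennreal ((norm (gl l t))\<^sup>2) \<partial>lborel) \<partial>lborel)"
  proof (rule nn_integral_mono)
    fix l :: real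
    show "(\<integral>\<^sup>+x. ennreal (4 * q * l powr (q - 3) * indicator {0<..} l) * ennreal ((norm (fourier (gl l) x))\<^sup>2) \<partial>lborel)
      \<le> (\<integral>\<^sup>+t. ennreal (4 * q * l powr (q - 3) * indicator {0<..} l) * ennreal ((norm (gl l t))\<^sup>2) \<partial>lborel)"
      using plancherel_le[OF gl_int[of l]]
      by (subst (1 2) nn_integral_cmult) (auto intro!: mult_left_mono)
  qed
  also have "\<dots> = (\<integral>\<^sup>+t. (\<integral>\<^sup>+l. ennreal (4 * q * l powr (q - 3) * indicator {0<..} l) * ennreal ((norm (gl l t))\<^sup>2) \<partial>lborel) \<partial>lborel)"
    by (rule lborel_pair.Fubini') measurable
  also have "\<dots> \<le> (\<integral>\<^sup>+t. ennreal (4 * q * (2 * A) powr (q - 2) / (q - 2)) * ennreal (norm (g t) powr (q / (q - 1))) \<partial>lborel)"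
  proof (rule nn_integral_mono)
    fix t
    show "(\<integral>\<^sup>+l. ennreal (4 * q * l powr (q - 3) * indicator {0<..} l) * ennreal ((norm (gl l t))\<^sup>2) \<partial>lborel)
      \<le> ennreal (4 * q * (2 * A) powr (q - 2) / (q - 2)) * ennreal (norm (g t) powr (q / (q - 1)))"
    proof (cases "g t = 0")
      case True
      then have "gl l t = 0" for l by (simp add: gl_def)
      then show ?thesis by simp
    next
      case False
      \<comment> \<open>Inverting the cut-off: \<open>norm (g t) \<le> s l\<close> forces
        \<open>l \<le> v\<close>. The integral of \<open>l powr (q - 3)\<close> up to
        \<open>v\<close> converges because \<open>q > 2\<close> and produces the factor
        \<open>1 / (q - 2)\<close>.\<close>
      define v where "v = 2 * A * norm (g t) powr (- 1 / (q - 1))"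
      have v0: "v > 0" using False A by (simp add: v_def)
      have lv: "l \<le> v" if "l > 0" "norm (g t) \<le> s l" for l
      proof -
        have "s l powr (- 1 / (q - 1)) \<le> norm (g t) powr (- 1 / (q - 1))"
          using that False q by (intro powr_mono2') (auto simp: field_simps)
        moreover have "- (q - 1) * (- 1 / (q - 1)) = 1" using q by (simp add: field_simps)
        then have "s l powr (- 1 / (q - 1)) = l / (2 * A)"
          using that A by (simp add: s_def powr_powr)
        ultimately have "l / (2 * A) \<le> norm (g t) powr (- 1 / (q - 1))" by simp
        then show ?thesis using A by (simp add: v_def pos_divide_le_eq mult.commute)
      qed
      have "(\<integral>\<^sup>+l. ennreal (4 * q * l powr (q - 3) * indicator {0<..} l) * ennreal ((norm (gl l t))\<^sup>2) \<partial>lborel)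
        \<le> (\<integral>\<^sup>+l. ennreal (4 * q * (norm (g t))\<^sup>2) * (ennreal (l powr (q - 3)) * indicator {0..v} l) \<partial>lborel)"
      proof (intro nn_integral_mono)
        fix l :: real
        show "ennreal (4 * q * l powr (q - 3) * indicator {0<..} l) * ennreal ((norm (gl l t))\<^sup>2)
          \<le> ennreal (4 * q * (norm (g t))\<^sup>2) * (ennreal (l powr (q - 3)) * indicator {0..v} l)"
        proof (cases "l > 0 \<and> norm (g t) \<le> s l")
          case True
          then have "l \<le> v" using lv by blast
          then show ?thesis using True q
            by (simp add: gl_def ennreal_mult[symmetric] mult_ac)
        qed (auto simp: gl_def)
      qed
      also have "\<dots> = ennreal (4 * q * (norm (g t))\<^sup>2) * (\<integral>\<^sup>+l. ennreal (l powr (q - 3)) * indicator {0..v} l \<partial>lborel)"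
        by (rule nn_integral_cmult) measurable
      also have "\<dots> = ennreal (4 * q * (norm (g t))\<^sup>2) * ennreal (v powr (q - 3 + 1) / (q - 3 + 1))"
        using q v0 by (subst nn_integral_powr_Icc) auto
      also have "\<dots> = ennreal (4 * q * (norm (g t))\<^sup>2 * (v powr (q - 2) / (q - 2)))"
        using q by (subst ennreal_mult[symmetric]) auto
      also have "4 * q * (norm (g t))\<^sup>2 * (v powr (q - 2) / (q - 2)) =
        4 * q * (2 * A) powr (q - 2) / (q - 2) * norm (g t) powr (q / (q - 1))"
      proof -
        have e: "q / (q - 1) = 2 + (- 1 / (q - 1)) * (q - 2)" using q by (simp add: field_simps)
        have "norm (g t) powr (q / (q - 1)) = (norm (g t))\<^sup>2 * (norm (g t) powr (- 1 / (q - 1))) powr (q - 2)"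
          unfolding e powr_add powr_powr using False by (simp add: powr_numeral)
        then show ?thesis using A by (simp add: v_def powr_mult)
      qed
      also have "ennreal \<dots> = ennreal (4 * q * (2 * A) powr (q - 2) / (q - 2)) * ennreal (norm (g t) powr (q / (q - 1)))"
        using q by (intro ennreal_mult) auto
      finally show ?thesis .
    qed
  qed
  also have "\<dots> = ennreal (4 * q * (2 * A) powr (q - 2) / (q - 2)) * (\<integral>\<^sup>+t. ennreal (norm (g t) powr (q / (q - 1))) \<partial>lborel)"
    by (rule nn_integral_cmult) measurable
  also have "\<dots> \<le> ennreal (4 * q * (2 * A) powr (q - 2) / (q - 2)) * ennreal A"
    by (intro mult_left_mono gA) auto
  also have "\<dots> = ennreal (4 * q * (2 * A) powr (q - 2) / (q - 2) * A)"
    using q A by (intro ennreal_mult[symmetric]) auto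
  also have "4 * q * (2 * A) powr (q - 2) / (q - 2) * A = q * 2 powr q / (q - 2) * A powr (q - 1)"
  proof -
    have "2 powr q = (2::real) powr 2 * 2 powr (q - 2)" "A powr (q - 1) = A powr 1 * A powr (q - 2)"
      by (simp_all only: powr_add[symmetric]) simp_all
    then show ?thesis using A by (simp add: powr_mult powr_numeral)
  qed
  finally show ?thesis .
qed

text \<open>The cut-off height in \<open>hausdorff_young_pos\<close> divides by \<open>A\<close>, so
  the case \<open>A = 0\<close>, where \<open>g\<close> vanishes almost everywhere, is treated
  apart.\<close>

lemma hausdorff_young:
  fixes q A :: real and g :: "real \<Rightarrow> complex"
  assumes q: "q > 2" and g: "integrable lborel g" and A: "A \<ge> 0"
    and gA: "(\<integral>\<^sup>+t. ennreal (norm (g t) powr (q / (q - 1))) \<partial>lborel) \<le> ennreal A"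
  shows "(\<integral>\<^sup>+x. ennreal (norm (fourier g x) powr q) \<partial>lborel)
    \<le> ennreal (q * 2 powr q / (q - 2) * A powr (q - 1))"
proof (cases "A = 0")
  case True
  have [measurable]: "g \<in> borel_measurable borel" using g by auto
  from gA True have "(\<integral>\<^sup>+t. ennreal (norm (g t) powr (q / (q - 1))) \<partial>lborel) = 0"
    by simp
  then have "AE t in lborel. g t = 0"
    by (subst (asm) nn_integral_0_iff_AE) auto
  then have "fourier g x = 0" for x
    unfolding fourier_def by (intro integral_eq_zero_AE) auto
  then show ?thesis by simp
qed (use assms hausdorff_young_pos in auto)

section \<open>A weighted inequality for the real Laplace transform\<close>

text \<open>Euler's integral for Gamma after the substitution of \<open>c * t\<close> for
  \<open>t\<close>.\<close>

lemma nn_integral_powr_exp: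
  fixes a c :: real
  assumes a: "a > -1" and c: "c > 0"
  shows "(\<integral>\<^sup>+t\<in>{0<..}. ennreal (t powr a * exp (- (c * t))) \<partial>lborel) = ennreal (Gamma (a + 1) * c powr (- a - 1))"
proof -
  let ?I = "\<integral>\<^sup>+t\<in>{0<..}. ennreal (t powr a * exp (- (c * t))) \<partial>lborel"
  have "ennreal (Gamma (a + 1)) = (\<integral>\<^sup>+t. ennreal (indicator {0..} t * t powr a / exp t) \<partial>lborel)"
    using Gamma_conv_nn_integral_real[of "a + 1"] a by simp
  also have "\<dots> = ennreal \<bar>c\<bar> * (\<integral>\<^sup>+t. ennreal (indicator {0..} (0 + c * t) * (0 + c * t) powr a / exp (0 + c * t)) \<partial>lborel)"
    using c by (intro nn_integral_real_affine) auto
  also have "(\<integral>\<^sup>+t. ennreal (indicator {0..} (0 + c * t) * (0 + c * t) powr a / exp (0 + c * t)) \<partial>lborel)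
    = (\<integral>\<^sup>+t. ennreal (c powr a) * (ennreal (t powr a * exp (- (c * t))) * indicator {0<..} t) \<partial>lborel)"
  proof (intro nn_integral_cong)
    fix t :: real
    \<comment> \<open>The two indicators differ only at \<open>t = 0\<close>, where
      \<open>0 powr a\<close> is 0.\<close>
    show "ennreal (indicator {0..} (0 + c * t) * (0 + c * t) powr a / exp (0 + c * t)) =
      ennreal (c powr a) * (ennreal (t powr a * exp (- (c * t))) * indicator {0<..} t)"
      using c by (cases "t > 0"; cases "t = 0")
        (auto simp: powr_mult exp_minus field_simps zero_le_mult_iff simp flip: ennreal_mult)
  qed
  also have "\<dots> = ennreal (c powr a) * ?I"
    by (rule nn_integral_cmult) measurable
  finally have *: "ennreal (Gamma (a + 1)) = ennreal (c powr (a + 1)) * ?I"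
    using c by (simp add: powr_add mult.assoc[symmetric] mult_ac flip: ennreal_mult)
  \<comment> \<open>Multiplying by the inverse power solves \<open>*\<close> for the integral
    without knowing beforehand that it is finite.\<close>
  have "?I = ennreal (c powr (- a - 1) * c powr (a + 1)) * ?I"
    using c by (simp flip: powr_add)
  also have "\<dots> = ennreal (c powr (- a - 1)) * ennreal (Gamma (a + 1))"
    unfolding * by (simp add: ennreal_mult mult.assoc)
  finally show ?thesis using c a by (simp add: mult_ac flip: ennreal_mult)
qed

text \<open>Young's inequality is applied pointwise to \<open>f\<close> and \<open>g\<close>
  normalised by the roots of \<open>X\<close> and \<open>Y\<close>, then integrated. Real upper
  bounds replace the two integrals, so the conclusion contains only real powers; when
  \<open>X = 0\<close> the normalisation is impossible, but \<open>f\<close> vanishes almost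
  everywhere.\<close>

lemma nn_integral_holder:
  fixes f g :: "'a \<Rightarrow> real"
  assumes s: "s > 1"
    and [measurable]: "f \<in> borel_measurable M" "g \<in> borel_measurable M"
    and f0: "\<And>x. f x \<ge> 0" and g0: "\<And>x. g x \<ge> 0"
    and X: "X \<ge> 0" "(\<integral>\<^sup>+x. ennreal (f x powr s) \<partial>M) \<le> ennreal X"
    and Y: "Y > 0" "(\<integral>\<^sup>+x. ennreal (g x powr (s / (s - 1))) \<partial>M) \<le> ennreal Y"
  shows "(\<integral>\<^sup>+x. ennreal (f x * g x) \<partial>M) \<le> ennreal (X powr (1 / s) * Y powr ((s - 1) / s))"
proof (cases "X = 0")
  case True
  then have "(\<integral>\<^sup>+x. ennreal (f x powr s) \<partial>M) = 0" using X by simp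
  then have "AE x in M. f x = 0"
    by (subst (asm) nn_integral_0_iff_AE) auto
  then have "(\<integral>\<^sup>+x. ennreal (f x * g x) \<partial>M) = 0"
    by (subst nn_integral_0_iff_AE) auto
  then show ?thesis by simp
next
  case False
  with X have X0: "X > 0" by simp
  define P where "P = X powr (1 / s) * Y powr ((s - 1) / s)"
  have P: "P > 0" using X0 Y by (simp add: P_def)
  have "(\<integral>\<^sup>+x. ennreal (f x * g x) \<partial>M) \<le>
    (\<integral>\<^sup>+x. ennreal (P / (s * X)) * ennreal (f x powr s) + ennreal (P * (s - 1) / (s * Y)) * ennreal (g x powr (s / (s - 1))) \<partial>M)"
  proof (intro nn_integral_mono)
    fix x
    have "f x / X powr (1 / s) * (g x / Y powr ((s - 1) / s)) \<le>
      (f x / X powr (1 / s)) powr s / s + (g x / Y powr ((s - 1) / s)) powr (s / (s - 1)) / (s / (s - 1))"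
      using s f0 g0 by (intro Youngs_inequality) (auto simp: field_simps)
    also have "(f x / X powr (1 / s)) powr s = f x powr s / X"
      using X0 s f0 by (simp add: powr_divide powr_powr)
    also have "(g x / Y powr ((s - 1) / s)) powr (s / (s - 1)) = g x powr (s / (s - 1)) / Y"
      using Y s g0 by (simp add: powr_divide powr_powr)
    finally have "f x * g x / P \<le> f x powr s / X / s + g x powr (s / (s - 1)) / Y / (s / (s - 1))"
      by (simp add: P_def)
    then have "f x * g x \<le> P * (f x powr s / X / s + g x powr (s / (s - 1)) / Y / (s / (s - 1)))"
      using P by (simp add: pos_divide_le_eq mult.commute)
    then have "f x * g x \<le> P / (s * X) * f x powr s + P * (s - 1) / (s * Y) * g x powr (s / (s - 1))"
      by (simp add: algebra_simps)
    then show "ennreal (f x * g x) \<le> ennreal (P / (s * X)) * ennreal (f x powr s) + ennreal (P * (s - 1) / (s * Y)) * ennreal (g x powr (s / (s - 1)))"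
      using P s X0 Y by (simp add: ennreal_leI flip: ennreal_mult ennreal_plus)
  qed
  also have "\<dots> = ennreal (P / (s * X)) * (\<integral>\<^sup>+x. ennreal (f x powr s) \<partial>M) + ennreal (P * (s - 1) / (s * Y)) * (\<integral>\<^sup>+x. ennreal (g x powr (s / (s - 1))) \<partial>M)"
    by (simp add: nn_integral_add nn_integral_cmult)
  also have "\<dots> \<le> ennreal (P / (s * X)) * ennreal X + ennreal (P * (s - 1) / (s * Y)) * ennreal Y"
    by (intro add_mono mult_left_mono X Y) auto
  also have "\<dots> = ennreal (P / (s * X) * X + P * (s - 1) / (s * Y) * Y)"
    using P s X0 Y by (simp flip: ennreal_mult ennreal_plus)
  also have "P / (s * X) * X + P * (s - 1) / (s * Y) * Y = P"
    using X0 Y s by (simp add: field_simps)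
  finally show ?thesis by (simp add: P_def)
qed

text \<open>Hoelder with the weight \<open>t powr (b / s)\<close> inserted and removed, and the
  exponential shared between the factors in proportion \<open>1 / s\<close> to
  \<open>(s - 1) / s\<close>. The dual factor is then a Gamma integral with exponent
  \<open>- b / (s - 1)\<close>, which converges at 0 exactly because
  \<open>b < s - 1\<close>.\<close>

lemma laplace_holder:
  fixes s b u X :: real and h :: "real \<Rightarrow> real"
  assumes s: "s > 1" and b: "b < s - 1" and u: "u > 0"
    and [measurable]: "h \<in> borel_measurable borel" and h0: "\<And>t. h t \<ge> 0"
    and X: "X \<ge> 0" "(\<integral>\<^sup>+t\<in>{0<..}. ennreal (h t powr s * t powr b * exp (- (u * t))) \<partial>lborel) \<le> ennreal X"
  shows "(\<integral>\<^sup>+t\<in>{0<..}. ennreal (h t * exp (- (u * t))) \<partial>lborel)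
    \<le> ennreal ((X * Gamma (1 - b / (s - 1)) powr (s - 1) * u powr (b - s + 1)) powr (1 / s))"
proof -
  define f where "f t = h t * t powr (b / s) * exp (- (u * t) / s) * indicator {0<..} t" for t :: real
  define g where "g t = t powr (- b / s) * exp (- (u * t) * (s - 1) / s) * indicator {0<..} t" for t :: real
  define Y where "Y = Gamma (1 - b / (s - 1)) * u powr (b / (s - 1) - 1)"
  have b1: "b / (s - 1) < 1" using s b by (simp add: field_simps)
  then have Gp: "Gamma (1 - b / (s - 1)) > 0" by (intro Gamma_real_pos) simp
  then have Y0: "Y > 0" using u by (simp add: Y_def)
  have "(\<integral>\<^sup>+t\<in>{0<..}. ennreal (h t * exp (- (u * t))) \<partial>lborel) = (\<integral>\<^sup>+t. ennreal (f t * g t) \<partial>lborel)"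
  proof (intro nn_integral_cong)
    fix t :: real
    have "exp (- (u * t)) = exp (- (u * t) / s) * exp (- (u * t) * (s - 1) / s)"
      using s by (simp add: field_simps flip: exp_add)
    moreover have "t powr (b / s) * t powr (- b / s) = 1" if "t > 0"
      using that by (simp flip: powr_add)
    ultimately have "f t * g t = h t * exp (- (u * t))" if "t > 0"
      using that by (simp add: f_def g_def)
    moreover have "f t = 0" if "\<not> t > 0" using that by (simp add: f_def)
    ultimately show "ennreal (h t * exp (- (u * t))) * indicator {0<..} t = ennreal (f t * g t)"
      by (cases "t > 0") simp_all
  qed
  also have "\<dots> \<le> ennreal (X powr (1 / s) * Y powr ((s - 1) / s))"
  proof (rule nn_integral_holder[OF s])
    show "f \<in> borel_measurable lborel" "g \<in> borel_measurable lborel"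
      unfolding f_def g_def by measurable
    have "(\<integral>\<^sup>+t. ennreal (f t powr s) \<partial>lborel) = (\<integral>\<^sup>+t\<in>{0<..}. ennreal (h t powr s * t powr b * exp (- (u * t))) \<partial>lborel)"
    proof (intro nn_integral_cong)
      fix t :: real
      show "ennreal (f t powr s) = ennreal (h t powr s * t powr b * exp (- (u * t))) * indicator {0<..} t"
        using s h0 by (cases "t > 0") (auto simp: f_def powr_mult powr_powr exp_powr_real)
    qed
    then show "(\<integral>\<^sup>+t. ennreal (f t powr s) \<partial>lborel) \<le> ennreal X" using X by simp
    have "(\<integral>\<^sup>+t. ennreal (g t powr (s / (s - 1))) \<partial>lborel) = (\<integral>\<^sup>+t\<in>{0<..}. ennreal (t powr (- b / (s - 1)) * exp (- (u * t))) \<partial>lborel)"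
    proof (intro nn_integral_cong)
      fix t :: real
      show "ennreal (g t powr (s / (s - 1))) = ennreal (t powr (- b / (s - 1)) * exp (- (u * t))) * indicator {0<..} t"
        using s by (cases "t > 0") (auto simp: g_def powr_mult powr_powr exp_powr_real)
    qed
    also have "\<dots> = ennreal Y"
      using b1 u by (subst nn_integral_powr_exp) (auto simp: Y_def)
    finally show "(\<integral>\<^sup>+t. ennreal (g t powr (s / (s - 1))) \<partial>lborel) \<le> ennreal Y" by simp
  qed (use h0 X Y0 in \<open>auto simp: f_def g_def\<close>)
  also have "X powr (1 / s) * Y powr ((s - 1) / s) = (X * Gamma (1 - b / (s - 1)) powr (s - 1) * u powr (b - s + 1)) powr (1 / s)"
  proof -
    have "(b / (s - 1) - 1) * ((s - 1) / s) = (b - s + 1) * (1 / s)"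
      using s by (simp add: field_simps)
    then show ?thesis using X Gp u s by (simp add: Y_def powr_mult powr_powr)
  qed
  finally show ?thesis .
qed

text \<open>The power of \<open>y\<close> is the one for which both sides scale alike under
  dilations of \<open>h\<close>. The inner integral is finite for \<open>y > 0\<close> by
  \<open>laplace_holder\<close> with \<open>b = \<alpha>\<close>, so \<open>enn2real\<close> never
  replaces an infinite value by 0 there.\<close>

lemma laplace_weighted_bound:
  fixes s r \<alpha> c :: real
  assumes s: "s > 1" and r: "r \<ge> s" and \<alpha>: "\<alpha> < s - 1" and c: "c > 0"
  obtains K where "K > 0" and
    "\<And>h N. h \<in> borel_measurable borel \<Longrightarrow> (\<And>t. h t \<ge> 0) \<Longrightarrow> N \<ge> 0 \<Longrightarrow>
      (\<integral>\<^sup>+t\<in>{0<..}. ennreal (h t powr s * t powr \<alpha>) \<partial>lborel) \<le> ennreal N \<Longrightarrow>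
      (\<integral>\<^sup>+y\<in>{0<..}. ennreal (enn2real (\<integral>\<^sup>+t\<in>{0<..}. ennreal (h t * exp (- (c * y * t))) \<partial>lborel) powr r
         * y powr (r * (1 - 1 / s - \<alpha> / s) - 1)) \<partial>lborel) \<le> ennreal (K * N powr (r / s))"
proof -
  define \<beta> where "\<beta> = r * (1 - 1 / s - \<alpha> / s) - 1"
  \<comment> \<open>The midpoint of the admissible interval: \<open>\<alpha> < b\<close> makes the
    later integral in \<open>y\<close> converge at 0, and \<open>b < s - 1\<close> is the condition
    of \<open>laplace_holder\<close>.\<close>
  define b where "b = (\<alpha> + s - 1) / 2"
  have b: "\<alpha> < b" "b < s - 1" using \<alpha> by (auto simp: b_def field_simps)
  define D where "D e = Gamma (1 - e / (s - 1)) powr (s - 1)" for e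
  have D: "D e > 0" if "e < s - 1" for e
  proof -
    have "1 - e / (s - 1) > 0" using that s by (simp add: field_simps)
    from Gamma_real_pos[OF this] show ?thesis by (simp add: D_def)
  qed
  \<comment> \<open>\<open>L\<close> collects the factors of the two bounds on \<open>G\<close> that
    depend on neither \<open>h\<close> nor \<open>y\<close>, apart from the power of
    \<open>N\<close>; \<open>K\<close> adds the constant from the integration in
    \<open>y\<close>.\<close>
  define L where "L = D \<alpha> powr (r / s - 1) * D b * c powr ((\<alpha> - s + 1) * (r / s - 1) + (b - s + 1))"
  have L: "L > 0" using D[of \<alpha>] D[of b] b \<alpha> c by (simp add: L_def)
  define K where "K = L * (Gamma (b - \<alpha>) * c powr (\<alpha> - b))"
  have K: "K > 0" using L b c Gamma_real_pos[of "b - \<alpha>"] by (simp add: K_def)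
  show thesis
  proof (rule that[OF K])
    fix h :: "real \<Rightarrow> real" and N :: real
    assume [measurable]: "h \<in> borel_measurable borel" and h0: "\<And>t. h t \<ge> 0" and N: "N \<ge> 0"
      and hN: "(\<integral>\<^sup>+t\<in>{0<..}. ennreal (h t powr s * t powr \<alpha>) \<partial>lborel) \<le> ennreal N"
    define G where "G y = enn2real (\<integral>\<^sup>+t\<in>{0<..}. ennreal (h t * exp (- (c * y * t))) \<partial>lborel)" for y
    define X where "X y = (\<integral>\<^sup>+t\<in>{0<..}. ennreal (h t powr s * t powr b * exp (- (c * y * t))) \<partial>lborel)" for y
    have Gs: "G y powr s \<le> Z * D e * (c * y) powr (e - s + 1)"
      if e: "e < s - 1" and y: "y > 0" and Z: "Z \<ge> 0"
        "(\<integral>\<^sup>+t\<in>{0<..}. ennreal (h t powr s * t powr e * exp (- (c * y * t))) \<partial>lborel) \<le> ennreal Z" for e y Z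
    proof -
      have u: "c * y > 0" using c y by simp
      let ?R = "Z * D e * (c * y) powr (e - s + 1)"
      have R: "?R \<ge> 0" using Z D[OF e] u by simp
      have "G y \<le> ?R powr (1 / s)"
        using laplace_holder[OF s e u _ h0 Z] unfolding G_def D_def by (intro enn2real_leI) auto
      then have "G y powr s \<le> (?R powr (1 / s)) powr s"
        using s by (intro powr_mono2) (auto simp: G_def)
      then show ?thesis using s R by (simp add: powr_powr)
    qed
    \<comment> \<open>With weight exponent \<alpha> the exponential can be bounded by 1, so
      \<open>N\<close> controls the integral for every \<open>y\<close> at once.\<close>
    have GN: "G y powr s \<le> N * D \<alpha> * (c * y) powr (\<alpha> - s + 1)" if y: "y > 0" for y
    proof (rule Gs[OF \<alpha> y N])
      have "(\<integral>\<^sup>+t\<in>{0<..}. ennreal (h t powr s * t powr \<alpha> * exp (- (c * y * t))) \<partial>lborel)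
        \<le> (\<integral>\<^sup>+t\<in>{0<..}. ennreal (h t powr s * t powr \<alpha>) \<partial>lborel)"
      proof (intro nn_integral_mono)
        fix t :: real
        have "h t powr s * t powr \<alpha> * exp (- (c * y * t)) \<le> h t powr s * t powr \<alpha> * 1" if "t > 0"
          using that c y by (intro mult_left_mono) auto
        then show "ennreal (h t powr s * t powr \<alpha> * exp (- (c * y * t))) * indicator {0<..} t \<le> ennreal (h t powr s * t powr \<alpha>) * indicator {0<..} t"
          by (cases "t > 0") (auto intro!: ennreal_leI)
      qed
      then show "(\<integral>\<^sup>+t\<in>{0<..}. ennreal (h t powr s * t powr \<alpha> * exp (- (c * y * t))) \<partial>lborel) \<le> ennreal N"
        using hN by (rule order_trans)
    qed
    show "(\<integral>\<^sup>+y\<in>{0<..}. ennreal (enn2real (\<integral>\<^sup>+t\<in>{0<..}. ennreal (h t * exp (- (c * y * t))) \<partial>lborel) powr r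
         * y powr (r * (1 - 1 / s - \<alpha> / s) - 1)) \<partial>lborel) \<le> ennreal (K * N powr (r / s))"
      unfolding G_def[symmetric] \<beta>_def[symmetric]
    proof (cases "N = 0")
      case True
      \<comment> \<open>For \<open>N = 0\<close> the factor \<open>N powr (r / s - 1)\<close> in
        \<open>pt\<close> would be 0 and could not absorb an infinite \<open>X y\<close>; here
        \<open>GN\<close> makes \<open>G\<close> vanish on the half-line.\<close>
      have "ennreal (G y powr r * y powr \<beta>) * indicator {0<..} y = 0" for y
        using GN[of y] True by (cases "y > 0") (auto simp: G_def)
      then have "(\<integral>\<^sup>+y\<in>{0<..}. ennreal (G y powr r * y powr \<beta>) \<partial>lborel) = (\<integral>\<^sup>+y. 0 \<partial>(lborel :: real measure))"
        by (intro nn_integral_cong)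
      then show "(\<integral>\<^sup>+y\<in>{0<..}. ennreal (G y powr r * y powr \<beta>) \<partial>lborel) \<le> ennreal (K * N powr (r / s))"
        by simp
    next
      case False
      then have N0: "N > 0" using N by simp
      have pt: "ennreal (G y powr r * y powr \<beta>) \<le> ennreal (L * N powr (r / s - 1)) * (ennreal (y powr (b - \<alpha> - 1)) * X y)"
        if y: "y > 0" for y
      proof (cases "X y = \<infinity>")
        case True
        then show ?thesis using y L N0 by (simp add: ennreal_mult_top ennreal_mult_eq_top_iff)
      next
        case False
        then obtain Z where Z: "Z \<ge> 0" "X y = ennreal Z" by (cases "X y") auto
        have 1: "G y powr s \<le> Z * D b * (c * y) powr (b - s + 1)"
          using Z by (intro Gs b y) (auto simp: X_def)
        have pw: "(N * D \<alpha> * (c * y) powr m) powr \<rho> * (Z * D b * (c * y) powr k) * y powr \<beta>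
          = D \<alpha> powr \<rho> * D b * c powr (m * \<rho> + k) * N powr \<rho> * (y powr (m * \<rho> + k + \<beta>) * Z)" for m \<rho> k
          by (simp add: powr_mult powr_powr powr_add mult_ac)
        \<comment> \<open>One factor \<open>G y powr s\<close> keeps the integral \<open>X y\<close>
          for Tonelli; the surplus power \<open>r / s - 1\<close>, nonnegative since
          \<open>s \<le> r\<close>, is spent on the crude bound \<open>GN\<close>.\<close>
        have "G y powr r = (G y powr s) powr (r / s - 1) * G y powr s"
          using s by (simp add: powr_powr algebra_simps flip: powr_add)
        also have "\<dots> \<le> (N * D \<alpha> * (c * y) powr (\<alpha> - s + 1)) powr (r / s - 1) * (Z * D b * (c * y) powr (b - s + 1))"
          using r s by (intro mult_mono 1 powr_mono2 GN y) (auto simp: field_simps)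
        finally have "G y powr r * y powr \<beta> \<le> (N * D \<alpha> * (c * y) powr (\<alpha> - s + 1)) powr (r / s - 1) * (Z * D b * (c * y) powr (b - s + 1)) * y powr \<beta>"
          by (rule mult_right_mono) simp
        also have "\<dots> = L * N powr (r / s - 1) * (y powr ((\<alpha> - s + 1) * (r / s - 1) + (b - s + 1) + \<beta>) * Z)"
          by (subst pw) (simp only: L_def mult.assoc)
        \<comment> \<open>The choice of \<beta> cancels all terms in \<open>r\<close>.\<close>
        also have "(\<alpha> - s + 1) * (r / s - 1) + (b - s + 1) + \<beta> = b - \<alpha> - 1"
          using s by (simp add: \<beta>_def field_simps)
        finally show ?thesis
          using L N0 Z by (simp add: ennreal_leI flip: ennreal_mult)
      qed
      have "(\<integral>\<^sup>+y\<in>{0<..}. ennreal (G y powr r * y powr \<beta>) \<partial>lborel)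
        \<le> (\<integral>\<^sup>+y. ennreal (L * N powr (r / s - 1)) * (ennreal (y powr (b - \<alpha> - 1)) * X y * indicator {0<..} y) \<partial>lborel)"
        using pt by (intro nn_integral_mono) (auto simp: indicator_def)
      also have "\<dots> = ennreal (L * N powr (r / s - 1)) * (\<integral>\<^sup>+y. ennreal (y powr (b - \<alpha> - 1)) * X y * indicator {0<..} y \<partial>lborel)"
        unfolding X_def by (rule nn_integral_cmult) measurable
      also have "(\<integral>\<^sup>+y. ennreal (y powr (b - \<alpha> - 1)) * X y * indicator {0<..} y \<partial>lborel)
        = (\<integral>\<^sup>+y. (\<integral>\<^sup>+t. ennreal (h t powr s * t powr b) * indicator {0<..} t * (ennreal (y powr (b - \<alpha> - 1) * exp (- (c * t * y))) * indicator {0<..} y) \<partial>lborel) \<partial>lborel)"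
      proof (intro nn_integral_cong)
        fix y :: real
        have "ennreal (y powr (b - \<alpha> - 1)) * X y * indicator {0<..} y
          = (\<integral>\<^sup>+t. (ennreal (y powr (b - \<alpha> - 1)) * indicator {0<..} y) * (ennreal (h t powr s * t powr b * exp (- (c * y * t))) * indicator {0<..} t) \<partial>lborel)"
          unfolding X_def by (subst nn_integral_cmult) (auto simp: mult_ac)
        also have "\<dots> = (\<integral>\<^sup>+t. ennreal (h t powr s * t powr b) * indicator {0<..} t * (ennreal (y powr (b - \<alpha> - 1) * exp (- (c * t * y))) * indicator {0<..} y) \<partial>lborel)"
          by (intro nn_integral_cong) (auto simp: ennreal_mult mult_ac)
        finally show "ennreal (y powr (b - \<alpha> - 1)) * X y * indicator {0<..} y = \<dots>" .
      qed
      also have "\<dots> = (\<integral>\<^sup>+t. (\<integral>\<^sup>+y. ennreal (h t powr s * t powr b) * indicator {0<..} t * (ennreal (y powr (b - \<alpha> - 1) * exp (- (c * t * y))) * indicator {0<..} y) \<partial>lborel) \<partial>lborel)"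
        by (rule lborel_pair.Fubini') measurable
      \<comment> \<open>The Gamma integral in \<open>y\<close> yields
        \<open>t powr (\<alpha> - b)\<close>, which turns the auxiliary weight
        \<open>t powr b\<close> back into \<open>t powr \<alpha>\<close>.\<close>
      also have "\<dots> = (\<integral>\<^sup>+t. ennreal (Gamma (b - \<alpha>) * c powr (\<alpha> - b)) * (ennreal (h t powr s * t powr \<alpha>) * indicator {0<..} t) \<partial>lborel)"
      proof (intro nn_integral_cong)
        fix t :: real
        show "(\<integral>\<^sup>+y. ennreal (h t powr s * t powr b) * indicator {0<..} t * (ennreal (y powr (b - \<alpha> - 1) * exp (- (c * t * y))) * indicator {0<..} y) \<partial>lborel)
          = ennreal (Gamma (b - \<alpha>) * c powr (\<alpha> - b)) * (ennreal (h t powr s * t powr \<alpha>) * indicator {0<..} t)"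
        proof (cases "t > 0")
          case True
          then have "(\<integral>\<^sup>+y. ennreal (h t powr s * t powr b) * indicator {0<..} t * (ennreal (y powr (b - \<alpha> - 1) * exp (- (c * t * y))) * indicator {0<..} y) \<partial>lborel)
            = ennreal (h t powr s * t powr b) * ennreal (Gamma (b - \<alpha> - 1 + 1) * (c * t) powr (- (b - \<alpha> - 1) - 1))"
            using b c by (subst nn_integral_cmult) (auto simp: nn_integral_powr_exp)
          also have "\<dots> = ennreal (h t powr s * t powr b * (Gamma (b - \<alpha>) * (c * t) powr (\<alpha> - b)))"
            by (simp add: ennreal_mult' )
          also have "h t powr s * t powr b * (Gamma (b - \<alpha>) * (c * t) powr (\<alpha> - b)) = Gamma (b - \<alpha>) * c powr (\<alpha> - b) * (h t powr s * (t powr b * t powr (\<alpha> - b)))"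
            using c True by (simp add: powr_mult mult_ac)
          also have "t powr b * t powr (\<alpha> - b) = t powr \<alpha>"
            by (simp flip: powr_add)
          finally show ?thesis using True b Gamma_real_pos[of "b - \<alpha>"] by (simp add: ennreal_mult)
        qed auto
      qed
      also have "\<dots> = ennreal (Gamma (b - \<alpha>) * c powr (\<alpha> - b)) * (\<integral>\<^sup>+t\<in>{0<..}. ennreal (h t powr s * t powr \<alpha>) \<partial>lborel)"
        by (rule nn_integral_cmult) measurable
      also have "ennreal (L * N powr (r / s - 1)) * \<dots> \<le> ennreal (L * N powr (r / s - 1)) * (ennreal (Gamma (b - \<alpha>) * c powr (\<alpha> - b)) * ennreal N)"
        by (intro mult_left_mono hN) auto
      also have "\<dots> = ennreal (K * (N powr (r / s - 1) * N powr 1))"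
        using L N0 b Gamma_real_pos[of "b - \<alpha>"] by (simp add: K_def mult_ac flip: ennreal_mult)
      also have "N powr (r / s - 1) * N powr 1 = N powr (r / s)"
        by (simp only: flip: powr_add) simp
      finally show "(\<integral>\<^sup>+y\<in>{0<..}. ennreal (G y powr r * y powr \<beta>) \<partial>lborel) \<le> ennreal (K * N powr (r / s))" .
    qed
  qed
qed

text \<open>Used twice below: for \<open>norm (g t)\<close> with exponent \<open>p\<close>, to make
  the Laplace integral converge absolutely, and for its \<open>q'\<close>-th power with exponent
  \<open>p / q'\<close>, to make \<open>enn2real\<close> faithful.\<close>

lemma nn_integral_laplace_finite:
  fixes s \<alpha> u :: real and h :: "real \<Rightarrow> real"
  assumes s: "s > 1" and \<alpha>: "\<alpha> < s - 1" and u: "u > 0"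
    and h: "h \<in> borel_measurable borel" "\<And>t. h t \<ge> 0"
    and fin: "(\<integral>\<^sup>+t\<in>{0<..}. ennreal (h t powr s * t powr \<alpha>) \<partial>lborel) < \<infinity>"
  shows "(\<integral>\<^sup>+t\<in>{0<..}. ennreal (h t * exp (- (u * t))) \<partial>lborel) < \<infinity>"
proof -
  obtain X where X: "X \<ge> 0" "(\<integral>\<^sup>+t\<in>{0<..}. ennreal (h t powr s * t powr \<alpha>) \<partial>lborel) = ennreal X"
    using fin by (cases "\<integral>\<^sup>+t\<in>{0<..}. ennreal (h t powr s * t powr \<alpha>) \<partial>lborel") auto
  have "(\<integral>\<^sup>+t\<in>{0<..}. ennreal (h t powr s * t powr \<alpha> * exp (- (u * t))) \<partial>lborel)
    \<le> (\<integral>\<^sup>+t\<in>{0<..}. ennreal (h t powr s * t powr \<alpha>) \<partial>lborel)"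
    using u by (intro nn_integral_mono)
      (auto simp: indicator_def intro!: ennreal_leI mult_left_le)
  then have "(\<integral>\<^sup>+t\<in>{0<..}. ennreal (h t powr s * t powr \<alpha> * exp (- (u * t))) \<partial>lborel) \<le> ennreal X"
    using X by simp
  from laplace_holder[OF s \<alpha> u h X(1) this] show ?thesis
    by (rule order_le_less_trans) simp
qed

section \<open>The Laplace transform on the upper half-plane\<close>

text \<open>On the disc about \<open>z\<close> that reaches down to the real axis, the exponential
  is expanded in powers of \<open>w - z\<close> and integrated term by term, so the transform is a
  convergent power series there.\<close>

lemma holomorphic_laplace_integral:
  fixes g :: "real \<Rightarrow> complex"
  assumes [measurable]: "g \<in> borel_measurable borel" and g0: "\<And>t. t \<le> 0 \<Longrightarrow> g t = 0"
    and int: "\<And>u. u > 0 \<Longrightarrow> integrable lborel (\<lambda>t. norm (g t) * exp (- (u * t)))"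
  shows "(\<lambda>z. LINT t|lborel. g t * exp (2 * of_real pi * \<i> * of_real t * z)) holomorphic_on {z. Im z > 0}"
proof -
  let ?F = "\<lambda>z. LINT t|lborel. g t * exp (2 * of_real pi * \<i> * of_real t * z)"
  have ball: "?F holomorphic_on ball z (Im z)" if z: "Im z > 0" for z
  proof -
    define a where "a n = (LINT t|lborel. g t * exp (2 * of_real pi * \<i> * of_real t * z) * ((2 * of_real pi * \<i> * of_real t) ^ n /\<^sub>R fact n))" for n
    have "(\<lambda>n. a n * (w - z) ^ n) sums ?F w" if w: "w \<in> ball z (Im z)" for w
    proof -
      \<comment> \<open>The partial sums grow at most like
        \<open>exp (2 * pi * t * norm (w - z))\<close> against the decay
        \<open>exp (- (2 * pi * t * Im z))\<close>; the net rate \<open>u\<close> is positive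
        exactly inside the disc.\<close>
      define u where "u = 2 * pi * (Im z - norm (w - z))"
      have u: "u > 0" using w by (simp add: u_def dist_norm norm_minus_commute)
      define e where "e t n = g t * exp (2 * of_real pi * \<i> * of_real t * z) * ((2 * of_real pi * \<i> * of_real t * (w - z)) ^ n /\<^sub>R fact n)" for t n
      have bound: "norm (\<Sum>n<N. e t n) \<le> norm (g t) * exp (- (u * t))" for N t
      proof (cases "t > 0")
        case True
        let ?v = "2 * of_real pi * \<i> * of_real t * (w - z)"
        have v: "norm ?v = 2 * pi * t * norm (w - z)" using True by (simp add: norm_mult)
        have "norm (\<Sum>n<N. ?v ^ n /\<^sub>R fact n) \<le> (\<Sum>n<N. norm ?v ^ n /\<^sub>R fact n)"
          by (rule order_trans[OF norm_sum]) (simp add: norm_power)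
        also have "\<dots> \<le> (\<Sum>n. norm ?v ^ n /\<^sub>R fact n)"
          by (intro sum_le_suminf summable_exp_generic) auto
        also have "\<dots> = exp (norm ?v)" by (simp add: exp_def)
        finally have 1: "norm (\<Sum>n<N. ?v ^ n /\<^sub>R fact n) \<le> exp (2 * pi * t * norm (w - z))" unfolding v .
        have 2: "norm (exp (2 * of_real pi * \<i> * of_real t * z)) = exp (- (2 * pi * t * Im z))"
          by (simp add: norm_exp_eq_Re)
        have "norm (\<Sum>n<N. e t n) = norm (g t) * (exp (- (2 * pi * t * Im z)) * norm (\<Sum>n<N. ?v ^ n /\<^sub>R fact n))"
          unfolding e_def sum_distrib_left[symmetric] norm_mult 2 by (simp only: mult.assoc)
        also have "\<dots> \<le> norm (g t) * (exp (- (2 * pi * t * Im z)) * exp (2 * pi * t * norm (w - z)))"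
          by (intro mult_left_mono 1) auto
        also have "exp (- (2 * pi * t * Im z)) * exp (2 * pi * t * norm (w - z)) = exp (- (u * t))"
          unfolding exp_add[symmetric] by (simp add: u_def algebra_simps)
        finally show ?thesis .
      qed (simp add: g0 e_def)
      have eint: "integrable lborel (\<lambda>t. e t n)" for n
      proof (rule Bochner_Integration.integrable_bound)
        show "integrable lborel (\<lambda>t. 2 * (norm (g t) * exp (- (u * t))))" using int[OF u] by simp
        show "(\<lambda>t. e t n) \<in> borel_measurable lborel" unfolding e_def by measurable
        have "norm (e t n) \<le> 2 * (norm (g t) * exp (- (u * t)))" for t
        proof -
          \<comment> \<open>A single term is a difference of two partial sums, whence the factor 2
            in its majorant.\<close>
          have "e t n = (\<Sum>n<Suc n. e t n) - (\<Sum>n<n. e t n)" by simp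
          then have "norm (e t n) \<le> norm (\<Sum>n<Suc n. e t n) + norm (\<Sum>n<n. e t n)"
            by (metis norm_triangle_ineq4)
          with bound[of t "Suc n"] bound[of t n] show ?thesis by linarith
        qed
        then show "AE t in lborel. norm (e t n) \<le> norm (2 * (norm (g t) * exp (- (u * t))))" by simp
      qed
      have lim: "(\<lambda>N. \<Sum>n<N. e t n) \<longlonglongrightarrow> g t * exp (2 * of_real pi * \<i> * of_real t * w)" for t
      proof -
        have "(\<lambda>n. e t n) sums (g t * exp (2 * of_real pi * \<i> * of_real t * z) * exp (2 * of_real pi * \<i> * of_real t * (w - z)))"
          unfolding e_def by (intro sums_mult exp_converges)
        also have "g t * exp (2 * of_real pi * \<i> * of_real t * z) * exp (2 * of_real pi * \<i> * of_real t * (w - z)) = g t * exp (2 * of_real pi * \<i> * of_real t * w)"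
          unfolding mult.assoc exp_add[symmetric] by (simp add: algebra_simps)
        finally show ?thesis by (simp add: sums_def)
      qed
      have "(\<lambda>N. LINT t|lborel. (\<Sum>n<N. e t n)) \<longlonglongrightarrow> ?F w"
      proof (rule integral_dominated_convergence)
        show "(\<lambda>t. g t * exp (2 * of_real pi * \<i> * of_real t * w)) \<in> borel_measurable lborel" by measurable
        show "(\<lambda>t. \<Sum>n<N. e t n) \<in> borel_measurable lborel" for N unfolding e_def by measurable
      qed (use int[OF u] bound lim in auto)
      also have "(\<lambda>N. LINT t|lborel. (\<Sum>n<N. e t n)) = (\<lambda>N. \<Sum>n<N. a n * (w - z) ^ n)"
      proof (intro ext)
        fix N
        have "(LINT t|lborel. e t n) = a n * (w - z) ^ n" for n
          unfolding a_def e_def integral_mult_left_zero[symmetric]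
          by (intro Bochner_Integration.integral_cong refl) (simp only: power_mult_distrib scaleR_conv_of_real mult_ac)
        then show "(LINT t|lborel. (\<Sum>n<N. e t n)) = (\<Sum>n<N. a n * (w - z) ^ n)"
          using eint by (simp add: Bochner_Integration.integral_sum)
      qed
      finally show ?thesis by (simp add: sums_def)
    qed
    then show ?thesis by (rule power_series_holomorphic)
  qed
  show ?thesis
    unfolding holomorphic_on_def
  proof
    fix z :: complex
    assume "z \<in> {z. Im z > 0}"
    then have "Im z > 0" by simp
    then have "?F field_differentiable at z"
      by (intro holomorphic_on_imp_differentiable_at[OF ball]) auto
    then show "?F field_differentiable (at z within {z. Im z > 0})"
      by (rule field_differentiable_at_within)
  qed
qed

section \<open>Reduction from Lebesgue to Borel measurable functions\<close>

text \<open>Tonelli and Fubini are applied over products of \<open>lborel\<close>, whereas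
  \<open>f\<close> is only Lebesgue measurable. Real and imaginary parts are replaced separately,
  and the indicator makes the vanishing off the half-line hold everywhere.\<close>

lemma halfline_borel_representative:
  fixes f :: "real \<Rightarrow> complex"
  assumes f: "f \<in> borel_measurable (lebesgue_on {0<..})"
  obtains g where "g \<in> borel_measurable borel" "\<And>t. t \<le> 0 \<Longrightarrow> g t = 0"
    "AE t in lborel. indicator {0<..} t *\<^sub>R f t = g t"
proof -
  have F: "(\<lambda>t. indicator {0<..} t *\<^sub>R f t) \<in> borel_measurable lebesgue"
    using f by (subst (asm) borel_measurable_restrict_space_iff) auto
  have "(\<lambda>t. Re (indicator {0<..} t *\<^sub>R f t)) \<in> borel_measurable lebesgue"
    "(\<lambda>t. Im (indicator {0<..} t *\<^sub>R f t)) \<in> borel_measurable lebesgue"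
    using F by measurable
  from this[THEN completion_ex_borel_measurable_real] obtain a b where
    ab: "a \<in> borel_measurable lborel" "b \<in> borel_measurable lborel"
    and ae: "AE t in lborel. Re (indicator {0<..} t *\<^sub>R f t) = a t" "AE t in lborel. Im (indicator {0<..} t *\<^sub>R f t) = b t"
    by auto
  note [measurable] = ab[simplified]
  show thesis
  proof
    show "(\<lambda>t. indicator {0<..} t *\<^sub>R (of_real (a t) + \<i> * of_real (b t))) \<in> borel_measurable borel" by measurable
    show "AE t in lborel. indicator {0<..} t *\<^sub>R f t = indicator {0<..} t *\<^sub>R (of_real (a t) + \<i> * of_real (b t))"
      using ae by eventually_elim (auto simp: complex_eq_iff indicator_def)
  qed auto
qed

lemma exp_laplace_kernel:
  "exp (2 * of_real pi * \<i> * of_real t * Complex x y) = of_real (exp (- (2 * pi * y * t))) * cis (2 * pi * t * x)"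
  by (simp add: exp_eq_polar mult_ac)

text \<open>Integrability is transferred along with the value, since equality of the integrals alone
  could be an equality of default zeros.\<close>

lemma laplace_eq_lborel:
  fixes f g :: "real \<Rightarrow> complex"
  assumes f: "f \<in> borel_measurable (lebesgue_on {0<..})" and [measurable]: "g \<in> borel_measurable borel"
    and fg: "AE t in lborel. indicator {0<..} t *\<^sub>R f t = g t"
  shows "set_integrable lebesgue {0<..} (laplace_integrand f z)
      \<longleftrightarrow> integrable lborel (\<lambda>t. g t * exp (2 * of_real pi * \<i> * of_real t * z))"
    and "laplace f z = (LINT t|lborel. g t * exp (2 * of_real pi * \<i> * of_real t * z))"
proof -
  let ?e = "\<lambda>t. exp (2 * of_real pi * \<i> * of_real t * z)"
  have [measurable]: "(\<lambda>t. indicator {0<..} t *\<^sub>R f t) \<in> borel_measurable lebesgue"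
    using f by (subst (asm) borel_measurable_restrict_space_iff) auto
  have [measurable]: "?e \<in> borel_measurable lebesgue" "g \<in> borel_measurable lebesgue"
    by (auto intro!: measurable_completion)
  have eq: "(\<lambda>t. indicator {0<..} t *\<^sub>R laplace_integrand f z t) = (\<lambda>t. (indicator {0<..} t *\<^sub>R f t) * ?e t)"
    by (auto simp: laplace_integrand_def)
  have ae: "AE t in lebesgue. (indicator {0<..} t *\<^sub>R f t) * ?e t = g t * ?e t"
  proof (rule AE_completion)
    show "AE t in lborel. (indicator {0<..} t *\<^sub>R f t) * ?e t = g t * ?e t"
      using fg by eventually_elim (simp only:)
  qed
  have m: "(\<lambda>t. (indicator {0<..} t *\<^sub>R f t) * ?e t) \<in> borel_measurable lebesgue"
    "(\<lambda>t. g t * ?e t) \<in> borel_measurable lebesgue" "(\<lambda>t. g t * ?e t) \<in> borel_measurable lborel"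
    by measurable
  show "set_integrable lebesgue {0<..} (laplace_integrand f z) \<longleftrightarrow> integrable lborel (\<lambda>t. g t * ?e t)"
    unfolding set_integrable_def eq integrable_cong_AE[OF m(1,2) ae] by (rule integrable_completion[OF m(3)])
  show "laplace f z = (LINT t|lborel. g t * ?e t)"
    unfolding laplace_def set_lebesgue_integral_def eq integral_cong_AE[OF m(1,2) ae] by (rule integral_completion[OF m(3)])
qed

section \<open>Assembly of the Bergman space bound\<close>

theorem theorem1p5:
  fixes p q \<alpha> :: real
  assumes "2 < p" and "p \<le> q" and "\<alpha> < p / conj_exponent q - 1"
  shows "\<exists>C>0. \<forall>f \<in> weighted_Lp p \<alpha>.
    (\<forall>z \<in> upper_half_plane. set_integrable lebesgue {0<..} (laplace_integrand f z)) \<and>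
    laplace f \<in> bergman_space q (q / conj_exponent p - 2 - \<alpha> * q / p) \<and>
    bergman_norm q (q / conj_exponent p - 2 - \<alpha> * q / p) (laplace f) \<le> C * weighted_Lp_norm p \<alpha> f"
proof -
  define \<beta> where "\<beta> = q / conj_exponent p - 2 - \<alpha> * q / p"
  define q' where "q' = q / (q - 1)"
  define s where "s = p / q'"
  define r where "r = q - 1"
  have p: "p > 2" and q: "q > 2" and pq: "p \<le> q" using assms by auto
  have q': "q' > 1" using q by (simp add: q'_def)
  have s_eq: "s = p * (q - 1) / q" using q by (simp add: s_def q'_def)
  have sp: "s \<le> p" using q' p by (simp add: s_def field_simps)
  \<comment> \<open>This is \<open>q' < 2 < p\<close> in multiplied-out form; it gives
    \<open>s > 1\<close>.\<close>
  have "q < 2 * (q - 1)" using q by simp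
  also have "\<dots> < p * (q - 1)" using p q by (intro mult_strict_right_mono) auto
  finally have s: "s > 1" using q by (simp add: s_eq)
  \<comment> \<open>Since \<open>r = q / q'\<close> and \<open>s = p / q'\<close>, the inequality
    \<open>s \<le> r\<close> is just \<open>p \<le> q\<close>.\<close>
  have "(q - 1) * (p / q) \<le> (q - 1) * 1" using pq q by (intro mult_left_mono) auto
  then have rs: "r \<ge> s" by (simp add: s_eq r_def mult.commute)
  have \<alpha>: "\<alpha> < s - 1" using assms(3) by (simp add: s_def q'_def conj_exponent_def)
  then have \<alpha>p: "\<alpha> < p - 1" using sp by simp
  have r_s: "r / s = q / p" using p q by (simp add: r_def s_eq)
  have \<beta>: "r * (1 - 1 / s - \<alpha> / s) - 1 = \<beta>"
  proof -
    have "r * (1 - 1 / s - \<alpha> / s) - 1 = r - r / s * (1 + \<alpha>) - 1"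
      by (simp add: algebra_simps add_divide_distrib)
    also have "\<dots> = \<beta>" unfolding r_s using p by (simp add: r_def \<beta>_def conj_exponent_def field_simps)
    finally show ?thesis .
  qed
  \<comment> \<open>The decay rate of \<open>norm (G y t) powr q'\<close> is
    \<open>2 * pi * q' * y\<close>.\<close>
  define c where "c = 2 * pi * q'"
  have c: "c > 0" using q' by (simp add: c_def)
  obtain K where K: "K > 0" and KH: "\<And>h N. h \<in> borel_measurable borel \<Longrightarrow> (\<And>t. h t \<ge> 0) \<Longrightarrow> N \<ge> 0 \<Longrightarrow>
      (\<integral>\<^sup>+t\<in>{0<..}. ennreal (h t powr s * t powr \<alpha>) \<partial>lborel) \<le> ennreal N \<Longrightarrow>
      (\<integral>\<^sup>+y\<in>{0<..}. ennreal (enn2real (\<integral>\<^sup>+t\<in>{0<..}. ennreal (h t * exp (- (c * y * t))) \<partial>lborel) powr r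
         * y powr \<beta>) \<partial>lborel) \<le> ennreal (K * N powr (r / s))"
    using laplace_weighted_bound[OF s rs \<alpha> c] unfolding \<beta> by blast
  define H where "H = q * 2 powr q / (q - 2)"
  have H: "H > 0" using q by (simp add: H_def)
  define C where "C = (H * K) powr (1 / q)"
  have C: "C > 0" using H K by (simp add: C_def)
  show ?thesis
    unfolding \<beta>_def[symmetric]
  proof (rule exI[of _ C], intro conjI C, rule ballI, intro conjI)
    fix f assume f: "f \<in> weighted_Lp p \<alpha>"
    then have fm: "f \<in> borel_measurable (lebesgue_on {0<..})" and ffin: "weighted_Lp_power p \<alpha> f < \<infinity>"
      by (auto simp: weighted_Lp_def)
    obtain g where gm [measurable]: "g \<in> borel_measurable borel" and g0: "\<And>t. t \<le> 0 \<Longrightarrow> g t = 0"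
      and fg: "AE t in lborel. indicator {0<..} t *\<^sub>R f t = g t"
      using halfline_borel_representative[OF fm] by blast
    define N where "N = enn2real (weighted_Lp_power p \<alpha> f)"
    have N0: "N \<ge> 0" by (simp add: N_def)
    have gN: "(\<integral>\<^sup>+t\<in>{0<..}. ennreal (norm (g t) powr p * t powr \<alpha>) \<partial>lborel) = ennreal N"
    proof -
      have "(\<integral>\<^sup>+t\<in>{0<..}. ennreal (norm (g t) powr p * t powr \<alpha>) \<partial>lborel) = weighted_Lp_power p \<alpha> f"
        unfolding weighted_Lp_power_def nn_integral_completion
        using fg by (intro nn_integral_cong_AE) (auto elim!: eventually_mono simp: indicator_def)
      then show ?thesis using ffin by (simp add: N_def)
    qed
    have gint: "integrable lborel (\<lambda>t. norm (g t) * exp (- (u * t)))" if u: "u > 0" for u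
    proof -
      \<comment> \<open>The lemma is used here with \<open>p\<close> in place of \<open>s\<close>;
        its condition is \<open>\<alpha>p\<close>, which follows from
        \<open>\<alpha> < s - 1\<close> and \<open>s \<le> p\<close>.\<close>
      have "(\<integral>\<^sup>+t\<in>{0<..}. ennreal (norm (g t) * exp (- (u * t))) \<partial>lborel) < \<infinity>"
        using p gN by (intro nn_integral_laplace_finite[OF _ \<alpha>p u]) auto
      also have "(\<integral>\<^sup>+t\<in>{0<..}. ennreal (norm (g t) * exp (- (u * t))) \<partial>lborel) = (\<integral>\<^sup>+t. ennreal (norm (norm (g t) * exp (- (u * t)))) \<partial>lborel)"
        by (intro nn_integral_cong) (auto simp: g0 indicator_def)
      finally show ?thesis by (intro integrableI_bounded) auto
    qed
    define G where "G y t = g t * of_real (exp (- (2 * pi * y * t)))" for y t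
    have Gm [measurable]: "G y \<in> borel_measurable borel" for y unfolding G_def by measurable
    have Gint: "integrable lborel (G y)" if y: "y > 0" for y
    proof (rule Bochner_Integration.integrable_bound)
      show "integrable lborel (\<lambda>t. norm (g t) * exp (- (2 * pi * y * t)))" using gint[of "2 * pi * y"] y by simp
      show "AE t in lborel. norm (G y t) \<le> norm (norm (g t) * exp (- (2 * pi * y * t)))"
        by (simp add: G_def norm_mult)
    qed measurable
    have F: "laplace f (Complex x y) = fourier (G y) x" for x y
      unfolding laplace_eq_lborel(2)[OF fm gm fg] fourier_def exp_laplace_kernel G_def by (simp only: mult.assoc)
    show "\<forall>z\<in>upper_half_plane. set_integrable lebesgue {0<..} (laplace_integrand f z)"
    proof
      fix z assume "z \<in> upper_half_plane"
      then have "integrable lborel (G (Im z))" by (intro Gint) (simp add: upper_half_plane_def)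
      then have "integrable lborel (\<lambda>t. G (Im z) t * cis (2 * pi * t * Re z))"
        by (rule integrable_mult_cis) measurable
      also have "(\<lambda>t. G (Im z) t * cis (2 * pi * t * Re z)) = (\<lambda>t. g t * exp (2 * of_real pi * \<i> * of_real t * z))"
        using exp_laplace_kernel[of _ "Re z" "Im z"] by (simp add: G_def mult.assoc)
      finally show "set_integrable lebesgue {0<..} (laplace_integrand f z)"
        unfolding laplace_eq_lborel(1)[OF fm gm fg] .
    qed
    have hol: "laplace f holomorphic_on upper_half_plane"
      using holomorphic_laplace_integral[OF gm g0 gint]
      unfolding laplace_eq_lborel(2)[OF fm gm fg, abs_def] upper_half_plane_def by blast
    define h where "h t = norm (g t) powr q'" for t
    have hm [measurable]: "h \<in> borel_measurable borel" unfolding h_def by measurable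
    have hs: "h t powr s = norm (g t) powr p" for t
      using q' by (simp add: h_def powr_powr s_def)
    have hN: "(\<integral>\<^sup>+t\<in>{0<..}. ennreal (h t powr s * t powr \<alpha>) \<partial>lborel) = ennreal N"
      unfolding hs by (rule gN)
    define M where "M y = enn2real (\<integral>\<^sup>+t\<in>{0<..}. ennreal (h t * exp (- (c * y * t))) \<partial>lborel)" for y
    have hy: "(\<integral>\<^sup>+x. ennreal (norm (laplace f (Complex x y)) powr q) \<partial>lborel) \<le> ennreal (H * M y powr r)" if y: "y > 0" for y
      unfolding F H_def r_def
    proof (rule hausdorff_young[OF q Gint[OF y]])
      \<comment> \<open>Finiteness ensures that \<open>ennreal (M y)\<close> is the integral itself
        and not the value 0 that \<open>enn2real\<close> assigns to infinity.\<close>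
      have "(\<integral>\<^sup>+t\<in>{0<..}. ennreal (h t * exp (- (c * y * t))) \<partial>lborel) < \<infinity>"
        using y c hN by (intro nn_integral_laplace_finite[OF s \<alpha>]) (auto simp: h_def)
      moreover have "(\<integral>\<^sup>+t. ennreal (norm (G y t) powr (q / (q - 1))) \<partial>lborel) = (\<integral>\<^sup>+t\<in>{0<..}. ennreal (h t * exp (- (c * y * t))) \<partial>lborel)"
      proof (intro nn_integral_cong)
        fix t :: real
        have "norm (G y t) powr q' = h t * exp (- (c * y * t))"
          by (simp add: G_def norm_mult powr_mult exp_powr_real h_def c_def mult_ac)
        then show "ennreal (norm (G y t) powr (q / (q - 1))) = ennreal (h t * exp (- (c * y * t))) * indicator {0<..} t"
          unfolding q'_def[symmetric] by (auto simp: indicator_def h_def g0)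
      qed
      ultimately show "(\<integral>\<^sup>+t. ennreal (norm (G y t) powr (q / (q - 1))) \<partial>lborel) \<le> ennreal (M y)"
        by (simp add: M_def)
    qed (simp add: M_def)
    have "bergman_power q \<beta> (laplace f) \<le> (\<integral>\<^sup>+y\<in>{0<..}. ennreal H * ennreal (M y powr r * y powr \<beta>) \<partial>lborel)"
      unfolding bergman_power_def
    proof (rule nn_integral_mono)
      fix y :: real
      show "(\<integral>\<^sup>+x. ennreal (norm (laplace f (Complex x y)) powr q * y powr \<beta>) \<partial>lborel) * indicator {0<..} y
        \<le> ennreal H * ennreal (M y powr r * y powr \<beta>) * indicator {0<..} y"
      proof (cases "y > 0")
        case True
        have "(\<integral>\<^sup>+x. ennreal (norm (laplace f (Complex x y)) powr q * y powr \<beta>) \<partial>lborel)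
          = (\<integral>\<^sup>+x. ennreal (norm (laplace f (Complex x y)) powr q) \<partial>lborel) * ennreal (y powr \<beta>)"
          unfolding F by (subst nn_integral_multc[symmetric]) (auto simp: ennreal_mult)
        also have "\<dots> \<le> ennreal (H * M y powr r) * ennreal (y powr \<beta>)"
          by (intro mult_right_mono hy True) auto
        finally show ?thesis using True H by (simp add: ennreal_mult mult.assoc)
      qed auto
    qed
    also have "\<dots> = (\<integral>\<^sup>+y. ennreal H * (ennreal (M y powr r * y powr \<beta>) * indicator {0<..} y) \<partial>lborel)"
      by (simp only: mult.assoc)
    also have "\<dots> = ennreal H * (\<integral>\<^sup>+y\<in>{0<..}. ennreal (M y powr r * y powr \<beta>) \<partial>lborel)"
      unfolding M_def by (rule nn_integral_cmult) measurable
    also have "\<dots> \<le> ennreal H * ennreal (K * N powr (r / s))"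
      unfolding M_def using KH[OF hm _ N0] hN by (intro mult_left_mono) (auto simp: h_def)
    also have "\<dots> = ennreal (H * K * N powr (q / p))"
      using H K by (simp add: r_s mult.assoc flip: ennreal_mult)
    finally have B: "bergman_power q \<beta> (laplace f) \<le> ennreal (H * K * N powr (q / p))" .
    then show "laplace f \<in> bergman_space q \<beta>"
      using hol by (auto simp: bergman_space_def intro: order_le_less_trans)
    have "enn2real (bergman_power q \<beta> (laplace f)) \<le> H * K * N powr (q / p)"
      using H K by (intro enn2real_leI B) auto
    \<comment> \<open>The \<open>q\<close>-th root turns \<open>N powr (q / p)\<close> into
      \<open>N powr (1 / p)\<close>, the norm of \<open>f\<close>, and \<open>H * K\<close> into
      \<open>C\<close>.\<close>
    then have "bergman_norm q \<beta> (laplace f) \<le> (H * K * N powr (q / p)) powr (1 / q)"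
      unfolding bergman_norm_def using q by (intro powr_mono2) auto
    also have "\<dots> = C * weighted_Lp_norm p \<alpha> f"
      using q by (simp add: C_def weighted_Lp_norm_def N_def powr_mult powr_powr)
    finally show "bergman_norm q \<beta> (laplace f) \<le> C * weighted_Lp_norm p \<alpha> f" .
  qed
qed

end
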